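(* Let $L>0$ and $a,b,c>0$, $p\in L^1[0,L]$, and consider the problem $$w''''(x)-\Big(a+b\int_0^L w(t)dt\Big)w''(x)+c\int_0^L w(t)dt=p(x)\ \text{a.e. in }(0,L),\quad w(0)=w(L)=w''(0)=w''(L)=0. \tag{P}$$ Let $M,N>0$ be constants with $N\le \frac{4M}{L^3}\sigma(\sqrt M L)$. Suppose (P) has a lower solution $\alpha$ and an upper solution $\beta$ such that $$0\le \alpha(x)\le\beta(x),\qquad 0\ge \alpha''(x)\ge\beta''(x)\quad\text{for all }x\in[0,L],$$ and $$a+b\int_0^L\beta(x)dx\le M,\qquad c-b\min_{x\in[0,L]}\beta''(x)\le N.$$ Then (P) has at least one solution in $[\alpha,\beta]:=\{u\in C^2[0,L]:\ \alpha\le u\le \beta,\ \alpha''\ge u''\ge \beta''\}$. Moreover, the sequences $(\alpha_n)$ and $(\beta_n)$ generated by the iteration below with $y_0=\alpha_0:=\alpha$ and $y_0=\beta_0:=\beta$ respectively satisfy, for all $n\ge1$, $$\alpha=\alpha_0\le\alpha_1\le\cdots\le\alpha_n\le\beta_n\le\cdots\le\beta_1\le\beta_0=\beta,$$ $$\alpha''=\alpha_0''\ge\alpha_1''\ge\cdots\ge\alpha_n''\ge\beta_n''\ge\cdots\ge\beta_1''\ge\beta_0''=\beta'',$$ and $\alpha_n$, $\beta_n$ converge uniformly on $[0,L]$ to the minimal solution $\underline y$ and the maximal solution $\overline y$ of (P) in $[\alpha,\beta]$, respectively (i.e., every solution $y$ of (P) in $[\alpha,\beta]$ satisfies $\underline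 y\le y\le\overline y$ and $\underline y''\ge y''\ge \overline y''$).
   Context: $\sigma(t):=\dfrac{3t^3}{6t\cosh t+6t-12\sinh t-t^3}$ for $t>0$. A solution of (P) is $w\in W^{4,1}[0,L]$ satisfying (P). A lower solution of (P) is $\alpha\in W^{4,1}[0,L]$ with $\alpha''''-(a+b\int_0^L\alpha)\alpha''+c\int_0^L\alpha\le p$ a.e. in $(0,L)$ and $\alpha(0)=\alpha(L)=\alpha''(0)=\alpha''(L)=0$; an upper solution is defined the same way with the inequality reversed. The iteration: given $y_{n-1}$, $y_n\in W^{4,1}[0,L]$ is the unique solution (which exists for any $M,N>0$) of $$y_n''''-My_n''+N\int_0^L y_n(t)dt=p(x)+\Big(a+b\int_0^L y_{n-1}(t)dt\Big)y_{n-1}''-c\int_0^L y_{n-1}(t)dt-My_{n-1}''+N\int_0^L y_{n-1}(t)dt,$$ $y_n(0)=y_n(L)=y_n''(0)=y_n''(L)=0$, $n=1,2,\dots$. *)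

theory Defs
  imports "HOL-Analysis.Analysis"
begin

definition sigma :: "real \<Rightarrow> real" where
  "sigma t = 3 * t^3 / (6 * t * cosh t + 6 * t - 12 * sinh t - t^3)"

definition d1 :: "real \<Rightarrow> (real \<Rightarrow> real) \<Rightarrow> real \<Rightarrow> real" where
  "d1 L f x = vector_derivative f (at x within {0..L})"

definition d2 :: "real \<Rightarrow> (real \<Rightarrow> real) \<Rightarrow> real \<Rightarrow> real" where
  "d2 L f = d1 L (d1 L f)"

definition d3 :: "real \<Rightarrow> (real \<Rightarrow> real) \<Rightarrow> real \<Rightarrow> real" where
  "d3 L f = d1 L (d2 L f)"

text \<open>Fourth derivative: the (a.e. existing) classical derivative of the third one.\<close>
definition d4 :: "real \<Rightarrow> (real \<Rightarrow> real) \<Rightarrow> real \<Rightarrow> real" where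
  "d4 L f = d1 L (d3 L f)"

text \<open>Sobolev space W^{4,1}[0,L]: w is three times differentiable on [0,L]
  and w''' is absolutely continuous, i.e. an indefinite integral of an L^1 function.\<close>
definition W41 :: "real \<Rightarrow> (real \<Rightarrow> real) \<Rightarrow> bool" where
  "W41 L w \<longleftrightarrow>
     (\<forall>x\<in>{0..L}. w differentiable (at x within {0..L}) \<and>
                  d1 L w differentiable (at x within {0..L}) \<and>
                  d2 L w differentiable (at x within {0..L})) \<and>
     (\<exists>g. g absolutely_integrable_on {0..L} \<and>
          (\<forall>x\<in>{0..L}. d3 L w x = d3 L w 0 + integral {0..x} g))"

definition C2 :: "real \<Rightarrow> (real \<Rightarrow> real) \<Rightarrow> bool" where
  "C2 L u \<longleftrightarrow>
     (\<forall>x\<in>{0..L}. u differentiable (at x within {0..L}) \<and>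
                  d1 L u differentiable (at x within {0..L})) \<and>
     continuous_on {0..L} (d2 L u)"

definition bc :: "real \<Rightarrow> (real \<Rightarrow> real) \<Rightarrow> bool" where
  "bc L w \<longleftrightarrow> w 0 = 0 \<and> w L = 0 \<and> d2 L w 0 = 0 \<and> d2 L w L = 0"

definition is_solution ::
  "real \<Rightarrow> real \<Rightarrow> real \<Rightarrow> real \<Rightarrow> (real \<Rightarrow> real) \<Rightarrow> (real \<Rightarrow> real) \<Rightarrow> bool" where
  "is_solution L a b c p w \<longleftrightarrow> W41 L w \<and> bc L w \<and>
     (AE x in lborel. x \<in> {0<..<L} \<longrightarrow>
        d4 L w x - (a + b * integral {0..L} w) * d2 L w x + c * integral {0..L} w = p x)"

definition is_lower_solution ::
  "real \<Rightarrow> real \<Rightarrow> real \<Rightarrow> real \<Rightarrow> (real \<Rightarrow> real) \<Rightarrow> (real \<Rightarrow> real) \<Rightarrow> bool" where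
  "is_lower_solution L a b c p w \<longleftrightarrow> W41 L w \<and> bc L w \<and>
     (AE x in lborel. x \<in> {0<..<L} \<longrightarrow>
        d4 L w x - (a + b * integral {0..L} w) * d2 L w x + c * integral {0..L} w \<le> p x)"

definition is_upper_solution ::
  "real \<Rightarrow> real \<Rightarrow> real \<Rightarrow> real \<Rightarrow> (real \<Rightarrow> real) \<Rightarrow> (real \<Rightarrow> real) \<Rightarrow> bool" where
  "is_upper_solution L a b c p w \<longleftrightarrow> W41 L w \<and> bc L w \<and>
     (AE x in lborel. x \<in> {0<..<L} \<longrightarrow>
        d4 L w x - (a + b * integral {0..L} w) * d2 L w x + c * integral {0..L} w \<ge> p x)"

definition in_order_interval ::
  "real \<Rightarrow> (real \<Rightarrow> real) \<Rightarrow> (real \<Rightarrow> real) \<Rightarrow> (real \<Rightarrow> real) \<Rightarrow> bool" where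
  "in_order_interval L \<alpha> \<beta> u \<longleftrightarrow> C2 L u \<and>
     (\<forall>x\<in>{0..L}. \<alpha> x \<le> u x \<and> u x \<le> \<beta> x \<and> d2 L \<alpha> x \<ge> d2 L u x \<and> d2 L u x \<ge> d2 L \<beta> x)"

text \<open>y is the (unique) W^{4,1} solution of the linear iteration step with data z = y_{n-1}.\<close>
definition iter_step ::
  "real \<Rightarrow> real \<Rightarrow> real \<Rightarrow> real \<Rightarrow> (real \<Rightarrow> real) \<Rightarrow> real \<Rightarrow> real
   \<Rightarrow> (real \<Rightarrow> real) \<Rightarrow> (real \<Rightarrow> real) \<Rightarrow> bool" where
  "iter_step L a b c p M N z y \<longleftrightarrow> W41 L y \<and> bc L y \<and>
     (AE x in lborel. x \<in> {0<..<L} \<longrightarrow>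
        d4 L y x - M * d2 L y x + N * integral {0..L} y =
        p x + (a + b * integral {0..L} z) * d2 L z x - c * integral {0..L} z
            - M * d2 L z x + N * integral {0..L} z)"

end

theory Submission
  imports Defs
begin

text \<open>
  Everything rests on a maximum principle for the linear operator
  \<open>u'''' - M u'' + N \<integral>u\<close> with hinged boundary conditions: if its value \<open>h\<close> is nonnegative almost
  everywhere, then \<open>u \<ge> 0 \<ge> u''\<close>.  Writing \<open>G\<close> for the Dirichlet Green function of
  \<open>- d\<^sup>2 + M\<close>, \<open>e = G 1\<close>, \<open>\<phi> = x (L - x) / 2\<close>, \<open>\<psi> = G \<phi>\<close> and \<open>\<Psi> = \<integral>\<psi>\<close>, one finds
  \<open>- (1 + N \<Psi>) u''(x) = \<integral>((1 + N \<Psi>) G(x, s) - N e(x) \<psi>(s)) h(s) ds\<close>.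
  As \<open>e\<close> and \<open>\<psi>\<close> are concave and \<open>sinh\<close> is convex on the positive half-line, the kernel is
  nonnegative as soon as it is so to leading order at the corner \<open>x = 0\<close>, \<open>s = L\<close>, and this is
  precisely the bound on \<open>N\<close> in terms of \<open>\<sigma>\<close>.

  The conditions on \<open>M\<close>, \<open>N\<close> and \<open>\<beta>\<close> make the right-hand side of the iteration monotone below \<open>\<beta>\<close>
  for the order \<open>u \<le> v \<and> u'' \<ge> v''\<close>, so both sequences are monotone and squeeze every solution in
  the order interval.  Their second derivatives converge pointwise and boundedly; solving
  \<open>w'' = f\<close> twice with dominated convergence shows that the limits solve the problem.
\<close>

section \<open>Differentiation of indefinite integrals\<close>

text \<open>
  On disjoint intervals chosen by the Vitali covering lemma, the Henstock lemma bounds the total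
  error of the one-point Riemann sum, hence the total length of intervals with a large relative error.
\<close>

lemma negligible_Henstock_exceptional:
  fixes f :: "real \<Rightarrow> real"
  assumes f: "f integrable_on {a..b}" and "\<eta> > 0"
  shows "negligible {x\<in>{a..b}. \<forall>d>0. \<exists>y\<in>{a..b}. y \<noteq> x \<and> \<bar>y - x\<bar> < d \<and>
           \<bar>\<bar>y - x\<bar> * f x - integral {min x y..max x y} f\<bar> > \<eta> * \<bar>y - x\<bar>}" (is "negligible ?E")
  unfolding negligible_outer_le
proof (intro allI impI)
  fix e :: real assume "e > 0"
  \<comment> \<open>The factor 5 pays for the Vitali dilation and \<open>\<eta>\<close> for turning
    error into length: the selected intervals have total length below \<open>e' / \<eta>\<close>,
    their dilations at most \<open>e\<close>.\<close>
  define e' where "e' = \<eta> * e / 5"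
  have e': "e' > 0" using \<open>e > 0\<close> \<open>\<eta> > 0\<close> by (simp add: e'_def)
  obtain \<gamma> where \<gamma>: "gauge \<gamma>"
    and H: "\<And>p. \<lbrakk>p tagged_partial_division_of (cbox a b); \<gamma> fine p\<rbrakk> \<Longrightarrow>
             sum (\<lambda>(x,k). norm(measure lborel k *\<^sub>R f x - integral k f)) p < e'"
    by (rule Henstock_lemma[of f a b e']) (use f e' in auto)
  define J :: "real \<times> real \<Rightarrow> real set" where "J = (\<lambda>(x,y). {min x y..max x y})"
  define m :: "real \<times> real \<Rightarrow> real" where "m = (\<lambda>(x,y). (x + y) / 2)"
  define r :: "real \<times> real \<Rightarrow> real" where "r = (\<lambda>(x,y). \<bar>y - x\<bar> / 2)"
  have Jc: "J i = cball (m i) (r i)" for i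
  proof -
    obtain x y where i: "i = (x, y)" by (cases i)
    show ?thesis
      unfolding i J_def m_def r_def prod.case cball_eq_atLeastAtMost
      by (cases "x \<le> y") (simp_all add: min_def max_def field_simps)
  qed
  \<comment> \<open>Indices are pairs of a tag \<open>x\<close> and the other endpoint
    \<open>y\<close>, so each interval \<open>J (x,y)\<close> carries its tag as an endpoint and
    lies in the gauge set of that tag.\<close>
  define K where "K = {(x,y). x \<in> {a..b} \<and> y \<in> {a..b} \<and> y \<noteq> x \<and> J (x,y) \<subseteq> \<gamma> x \<and>
      \<bar>\<bar>y - x\<bar> * f x - integral {min x y..max x y} f\<bar> > \<eta> * \<bar>y - x\<bar>}"
  have EK: "?E \<subseteq> (\<Union>i\<in>K. cball (m i) (r i))"
  proof
    fix x assume x: "x \<in> ?E"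
    obtain d where d: "d > 0" "ball x d \<subseteq> \<gamma> x"
      using \<gamma> unfolding gauge_def by (meson open_contains_ball)
    from x d obtain y where y: "y \<in> {a..b}" "y \<noteq> x" "\<bar>y - x\<bar> < d"
        "\<bar>\<bar>y - x\<bar> * f x - integral {min x y..max x y} f\<bar> > \<eta> * \<bar>y - x\<bar>"
      by auto
    have "J (x,y) \<subseteq> ball x d"
      using y by (auto simp: J_def dist_real_def min_def max_def split: if_splits)
    then have "(x,y) \<in> K" using x y d unfolding K_def by auto
    moreover have "x \<in> J (x,y)" by (auto simp: J_def)
    ultimately show "x \<in> (\<Union>i\<in>K. cball (m i) (r i))"
      using Jc by blast
  qed
  have rK: "0 < r i \<and> r i \<le> \<bar>b - a\<bar>" if "i \<in> K" for i
    using that by (auto simp: K_def r_def split: prod.splits)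
  obtain C where C: "countable C" "C \<subseteq> K"
     "pairwise (\<lambda>i j. disjnt (cball (m i) (r i)) (cball (m j) (r j))) C"
     "?E \<subseteq> (\<Union>i\<in>C. cball (m i) (5 * r i))"
    by (rule Vitali_covering_lemma_cballs[OF EK rK])
  \<comment> \<open>The Henstock lemma concerns finite partial divisions, so only finite subfamilies
    are measured; the countable union inherits the bound.\<close>
  have bound: "measure lebesgue (\<Union>i\<in>D. cball (m i) (5 * r i)) \<le> e"
    if D: "D \<subseteq> C" "finite D" for D
  proof -
    define p where "p = (\<lambda>i. (fst i, J i)) ` D"
    have inj: "inj_on (\<lambda>i. (fst i, J i)) D"
    proof (rule inj_onI, rule ccontr)
      fix i j assume ij: "i \<in> D" "j \<in> D" "(fst i, J i) = (fst j, J j)" "i \<noteq> j"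
      then have "disjnt (J i) (J j)"
        using C(3) D Jc unfolding pairwise_def by (metis subsetD)
      moreover have "fst i \<in> J i" by (auto simp: J_def split: prod.splits)
      ultimately show False using ij by (auto simp: disjnt_def)
    qed
    have "p tagged_partial_division_of (cbox a b)"
      unfolding tagged_partial_division_of_def
    proof (intro conjI allI impI)
      show "finite p" using D by (simp add: p_def)
      fix x k assume xk: "(x,k) \<in> p"
      show "x \<in> k" using xk by (auto simp: p_def J_def split: prod.splits)
      show "k \<subseteq> cbox a b" using xk D C(2) by (fastforce simp: p_def J_def K_def)
      show "\<exists>a b. k = cbox a b" using xk unfolding p_def J_def by (force split: prod.splits)
    next
      fix x1 K1 x2 K2 assume "(x1, K1) \<in> p \<and> (x2, K2) \<in> p \<and> (x1, K1) \<noteq> (x2, K2)"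
      then obtain i j where "i \<in> D" "j \<in> D" "K1 = J i" "K2 = J j" "i \<noteq> j"
        by (auto simp: p_def)
      then have "disjnt K1 K2"
        using C(3) D Jc unfolding pairwise_def by (metis subsetD)
      then show "interior K1 \<inter> interior K2 = {}"
        using interior_subset unfolding disjnt_def by blast
    qed
    moreover have "\<gamma> fine p"
      using D C(2) unfolding fine_def p_def K_def by fastforce
    ultimately have "sum (\<lambda>(x,k). norm(measure lborel k *\<^sub>R f x - integral k f)) p < e'"
      by (rule H)
    then have S1: "(\<Sum>i\<in>D. \<bar>measure lborel (J i) * f (fst i) - integral (J i) f\<bar>) < e'"
      unfolding p_def by (subst (asm) sum.reindex[OF inj]) (simp add: o_def)
    have "(\<Sum>i\<in>D. \<eta> * (2 * r i)) \<le> (\<Sum>i\<in>D. \<bar>measure lborel (J i) * f (fst i) - integral (J i) f\<bar>)"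
    proof (rule sum_mono)
      fix i assume "i \<in> D"
      then have "i \<in> K" using D C by auto
      moreover have "measure lborel (J i) = \<bar>snd i - fst i\<bar>"
        by (auto simp: J_def min_def max_def split: prod.splits)
      ultimately show "\<eta> * (2 * r i) \<le> \<bar>measure lborel (J i) * f (fst i) - integral (J i) f\<bar>"
        by (auto simp: K_def r_def J_def split: prod.splits)
    qed
    with S1 have S2: "\<eta> * (\<Sum>i\<in>D. 2 * r i) < e'" by (simp add: sum_distrib_left)
    have "measure lebesgue (\<Union>i\<in>D. cball (m i) (5 * r i))
          \<le> (\<Sum>i\<in>D. measure lebesgue (cball (m i) (5 * r i)))"
      by (rule measure_UNION_le) (use D in auto)
    also have "\<dots> = (\<Sum>i\<in>D. 5 * (2 * r i))"
    proof (rule sum.cong)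
      fix i assume "i \<in> D"
      then have "r i > 0" using D C rK by blast
      then show "measure lebesgue (cball (m i) (5 * r i)) = 5 * (2 * r i)"
        by (simp add: cball_eq_atLeastAtMost)
    qed auto
    also have "\<dots> = 5 * (\<Sum>i\<in>D. 2 * r i)" by (simp add: sum_distrib_left)
    also have "\<dots> \<le> e"
      using S2 \<open>\<eta> > 0\<close> by (simp add: e'_def field_simps)
    finally show ?thesis .
  qed
  show "\<exists>T. ?E \<subseteq> T \<and> T \<in> lmeasurable \<and> measure lebesgue T \<le> e"
    using C(4) fmeasurable_UN_bound[OF C(1) _ bound] measure_UN_bound[OF C(1) _ bound]
    by (intro exI[of _ "\<Union>i\<in>C. cball (m i) (5 * r i)"]) auto
qed

text \<open>Outside the exceptional sets for all thresholds \<open>inverse (real (Suc n))\<close>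
  the derivative is as claimed, since some threshold lies below any given \<open>e\<close>. A
  countable union of negligible sets is negligible.\<close>

lemma integral_has_real_derivative_AE:
  fixes f :: "real \<Rightarrow> real"
  assumes f: "f integrable_on {a..b}"
  shows "negligible {x\<in>{a..b}. \<not> ((\<lambda>x. integral {a..x} f) has_real_derivative f x) (at x within {a..b})}"
    (is "negligible ?B")
proof -
  define E where "E = (\<lambda>\<eta>::real. {x\<in>{a..b}. \<forall>d>0. \<exists>y\<in>{a..b}. y \<noteq> x \<and> \<bar>y - x\<bar> < d \<and>
           \<bar>\<bar>y - x\<bar> * f x - integral {min x y..max x y} f\<bar> > \<eta> * \<bar>y - x\<bar>})"
  have "negligible (\<Union>n. E (inverse (real (Suc n))))"
  proof (intro negligible_countable_Union countable_image)
    fix T assume "T \<in> range (\<lambda>n. E (inverse (real (Suc n))))"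
    then show "negligible T"
      unfolding E_def using negligible_Henstock_exceptional[OF f, of "inverse (real (Suc n))" for n] by auto
  qed auto
  moreover have "?B \<subseteq> (\<Union>n. E (inverse (real (Suc n))))"
  proof (rule subsetI, rule ccontr)
    fix x assume x: "x \<in> ?B" and nE: "x \<notin> (\<Union>n. E (inverse (real (Suc n))))"
    have "((\<lambda>x. integral {a..x} f) has_real_derivative f x) (at x within {a..b})"
      unfolding has_field_derivative_def has_derivative_within_alt
    proof (intro conjI allI impI)
      show "bounded_linear ((*) (f x))" by (rule bounded_linear_mult_right)
      fix e :: real assume "e > 0"
      then obtain n where n: "inverse (real (Suc n)) < e" using reals_Archimedean by blast
      have "\<not> (\<forall>d>0. \<exists>y\<in>{a..b}. y \<noteq> x \<and> \<bar>y - x\<bar> < d \<and>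
           \<bar>\<bar>y - x\<bar> * f x - integral {min x y..max x y} f\<bar> > inverse (real (Suc n)) * \<bar>y - x\<bar>)"
        using nE x unfolding E_def by blast
      then obtain d where d: "d > 0" "\<And>y. y\<in>{a..b} \<Longrightarrow> y \<noteq> x \<Longrightarrow> \<bar>y - x\<bar> < d \<Longrightarrow>
           \<bar>\<bar>y - x\<bar> * f x - integral {min x y..max x y} f\<bar> \<le> inverse (real (Suc n)) * \<bar>y - x\<bar>"
        by (meson not_less)
      have "norm (integral {a..y} f - integral {a..x} f - f x * (y - x)) \<le> e * norm (y - x)"
        if y: "y \<in> {a..b}" "norm (y - x) < d" for y
      proof (cases "y = x")
        case False
        have *: "integral {a..u} f + integral {u..v} f = integral {a..v} f"
          if "a \<le> u" "u \<le> v" "v \<le> b" for u v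
          using that by (intro Henstock_Kurzweil_Integration.integral_combine
              integrable_on_subinterval[OF f]) auto
        have "\<bar>integral {a..y} f - integral {a..x} f - f x * (y - x)\<bar>
            = \<bar>\<bar>y - x\<bar> * f x - integral {min x y..max x y} f\<bar>"
          using *[of x y] *[of y x] x y by (cases "x \<le> y") (auto simp: min_def max_def abs_if algebra_simps)
        also have "\<dots> \<le> inverse (real (Suc n)) * \<bar>y - x\<bar>" using d y False by auto
        also have "\<dots> \<le> e * \<bar>y - x\<bar>" using n by (intro mult_right_mono) auto
        finally show ?thesis by simp
      qed simp
      then show "\<exists>d>0. \<forall>y\<in>{a..b}. norm (y - x) < d \<longrightarrow>
          norm (integral {a..y} f - integral {a..x} f - f x * (y - x)) \<le> e * norm (y - x)"
        using d by blast
    qed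
    with x show False by auto
  qed
  ultimately show ?thesis by (rule negligible_subset)
qed

section \<open>Integration by parts for absolutely continuous functions\<close>

lemma absolutely_integrable_continuous_mult:
  fixes K g :: "real \<Rightarrow> real"
  assumes "continuous_on {p..q} K" "g absolutely_integrable_on {p..q}"
  shows "(\<lambda>t. K t * g t) absolutely_integrable_on {p..q}"
proof (rule absolutely_integrable_bounded_measurable_product_real)
  show "K \<in> borel_measurable (lebesgue_on {p..q})"
    using assms by (intro continuous_imp_measurable_on_sets_lebesgue) auto
  show "bounded (K ` {p..q})"
    using assms compact_continuous_image compact_imp_bounded by blast
qed (use assms in auto)

text \<open>
  With \<open>A\<close> an indefinite integral of \<open>\<bar>g\<bar>\<close>, the difference \<open>P\<close> of the two sides satisfies
  \<open>\<bar>P y - P x\<bar> \<le> 2 C \<bar>y - x\<bar> \<bar>A y - A x\<bar>\<close>, so its derivative vanishes everywhere, not just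
  almost everywhere, and \<open>P\<close> is constant.
\<close>

lemma integral_by_parts_absolutely_continuous:
  fixes K K' F g :: "real \<Rightarrow> real"
  assumes "p \<le> q" and g: "g absolutely_integrable_on {p..q}"
    and F: "\<And>x y. p \<le> x \<Longrightarrow> x \<le> y \<Longrightarrow> y \<le> q \<Longrightarrow> F y - F x = integral {x..y} g"
    and K: "\<And>x. x \<in> {p..q} \<Longrightarrow> (K has_real_derivative K' x) (at x within {p..q})"
    and K': "continuous_on {p..q} K'"
  shows "((\<lambda>t. K t * g t + K' t * F t) has_integral (K q * F q - K p * F p)) {p..q}"
proof -
  have cK: "continuous_on {p..q} K"
    using K by (meson DERIV_continuous continuous_on_eq_continuous_within)
  have gi: "g integrable_on {p..q}" and agi: "(\<lambda>t. \<bar>g t\<bar>) integrable_on {p..q}"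
    using g by (auto simp: absolutely_integrable_on_def)
  have Feq: "F x = F p + integral {p..x} g" if "x \<in> {p..q}" for x
    using F[of p x] that by auto
  have cF: "continuous_on {p..q} F"
    using indefinite_integral_continuous_1[OF gi]
    by (subst continuous_on_cong[OF refl Feq]) (auto intro!: continuous_intros)
  define A where "A x = integral {p..x} (\<lambda>t. \<bar>g t\<bar>)" for x
  have cA: "continuous_on {p..q} A"
    unfolding A_def using indefinite_integral_continuous_1[OF agi] by simp
  have Adiff: "integral {x..y} (\<lambda>t. \<bar>g t\<bar>) = A y - A x" if "p \<le> x" "x \<le> y" "y \<le> q" for x y
    using Henstock_Kurzweil_Integration.integral_combine[of p x y "\<lambda>t. \<bar>g t\<bar>"]
      integrable_on_subinterval[OF agi, of p y] that unfolding A_def by auto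
  obtain C where C: "C > 0" "\<And>x. x \<in> {p..q} \<Longrightarrow> \<bar>K' x\<bar> \<le> C"
    using compact_imp_bounded[OF compact_continuous_image[OF K' compact_Icc]]
    unfolding bounded_pos by auto
  have Kg: "(\<lambda>t. K t * g t) integrable_on {p..q}"
    using absolutely_integrable_continuous_mult[OF cK g] by (auto simp: absolutely_integrable_on_def)
  have KF: "(\<lambda>t. K' t * F t) integrable_on {p..q}"
    by (intro integrable_continuous_interval continuous_intros K' cF)
  have int: "(\<lambda>t. K t * g t + K' t * F t) integrable_on {p..q}"
    using Kg KF by (rule integrable_add)
  define P where "P x = integral {p..x} (\<lambda>t. K t * g t + K' t * F t) - K x * F x" for x
  have est: "\<bar>P y - P x\<bar> \<le> 2 * C * (y - x) * (A y - A x)"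
    if xy: "p \<le> x" "x \<le> y" "y \<le> q" for x y
  proof -
    have sub: "f integrable_on {x..y}" if "f integrable_on {p..q}" for f :: "real \<Rightarrow> real"
      using integrable_on_subinterval[OF that, of x y] xy by auto
    have 1: "(K' has_integral (K y - K x)) {x..y}"
    proof (rule fundamental_theorem_of_calculus[OF xy(2)])
      fix t assume "t \<in> {x..y}"
      then show "(K has_vector_derivative K' t) (at t within {x..y})"
        using DERIV_subset[OF K, of t "{x..y}"] xy
        by (auto simp: has_real_derivative_iff_has_vector_derivative)
    qed
    have 2: "(g has_integral (F y - F x)) {x..y}"
      using F[OF xy] integrable_integral[OF sub[OF gi]] by simp
    have 3: "((\<lambda>t. K t * g t + K' t * F t) has_integral
        (integral {p..y} (\<lambda>t. K t * g t + K' t * F t) - integral {p..x} (\<lambda>t. K t * g t + K' t * F t))) {x..y}"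
    proof -
      have "integral {x..y} (\<lambda>t. K t * g t + K' t * F t)
          = integral {p..y} (\<lambda>t. K t * g t + K' t * F t) - integral {p..x} (\<lambda>t. K t * g t + K' t * F t)"
        using Henstock_Kurzweil_Integration.integral_combine[OF xy(1,2) integrable_on_subinterval[OF int, of p y]] xy
        by auto
      then show ?thesis using integrable_integral[OF sub[OF int]] by metis
    qed
    \<comment> \<open>Freezing \<open>K\<close> at the right end and \<open>F\<close> at the left
      end removes exactly the boundary terms, as \<open>K y * (F y - F x) + (K y - K x) * F x = K y
      * F y - K x * F x\<close>. Each remaining product integrates to at most
      \<open>C * (y - x) * (A y - A x)\<close> in absolute value.\<close>
    have "((\<lambda>t. (K t * g t + K' t * F t) - K y * g t - K' t * F x) has_integral
        (integral {p..y} (\<lambda>t. K t * g t + K' t * F t) - integral {p..x} (\<lambda>t. K t * g t + K' t * F t)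
          - K y * (F y - F x) - (K y - K x) * F x)) {x..y}"
      by (intro has_integral_diff 3 has_integral_mult_right has_integral_mult_left 1 2)
    then have 4: "((\<lambda>t. (K t - K y) * g t + K' t * (F t - F x)) has_integral (P y - P x)) {x..y}"
      by (simp add: P_def algebra_simps)
    have 5: "((\<lambda>t. C * (y - x) * \<bar>g t\<bar> + C * (A y - A x)) has_integral
        C * (y - x) * (A y - A x) + (y - x) * (C * (A y - A x))) {x..y}"
      using Adiff[OF xy] integrable_integral[OF sub[OF agi]] has_integral_const_real[of "C * (A y - A x)" x y] xy
      by (intro has_integral_add has_integral_mult_right) auto
    have "norm (P y - P x) \<le> C * (y - x) * (A y - A x) + (y - x) * (C * (A y - A x))"
      unfolding integral_unique[OF 4, symmetric] integral_unique[OF 5, symmetric]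
    proof (rule integral_norm_bound_integral)
      show "(\<lambda>t. (K t - K y) * g t + K' t * (F t - F x)) integrable_on {x..y}" using 4 by blast
      show "(\<lambda>t. C * (y - x) * \<bar>g t\<bar> + C * (A y - A x)) integrable_on {x..y}" using 5 by blast
      fix t assume t: "t \<in> {x..y}"
      have "norm (K t - K y) \<le> C * norm (t - y)"
        by (rule field_differentiable_bound[where S="{p..q}" and f'=K'])
          (use t xy C K in auto)
      also have "\<dots> \<le> C * (y - x)"
        using t C(1) by (intro mult_left_mono) auto
      finally have a: "\<bar>K t - K y\<bar> \<le> C * (y - x)" by simp
      have "\<bar>F t - F x\<bar> \<le> integral {x..t} (\<lambda>t. \<bar>g t\<bar>)"
        using F[of x t] t xy integral_norm_bound_integral[of g "{x..t}" "\<lambda>t. \<bar>g t\<bar>"]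
          integrable_on_subinterval[OF gi, of x t] integrable_on_subinterval[OF agi, of x t] by auto
      also have "\<dots> \<le> integral {x..y} (\<lambda>t. \<bar>g t\<bar>)"
        using t xy integrable_on_subinterval[OF agi, of x t] integrable_on_subinterval[OF agi, of x y]
        by (intro integral_subset_le) auto
      finally have b: "\<bar>F t - F x\<bar> \<le> A y - A x" using Adiff[OF xy] by simp
      have "\<bar>K t - K y\<bar> * \<bar>g t\<bar> \<le> C * (y - x) * \<bar>g t\<bar>" using a by (intro mult_right_mono) auto
      moreover have "\<bar>K' t\<bar> * \<bar>F t - F x\<bar> \<le> C * (A y - A x)"
        using b C(2)[of t] t xy C(1) by (intro mult_mono) auto
      ultimately show "norm ((K t - K y) * g t + K' t * (F t - F x)) \<le> C * (y - x) * \<bar>g t\<bar> + C * (A y - A x)"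
        using abs_triangle_ineq[of "(K t - K y) * g t" "K' t * (F t - F x)"] by (simp add: abs_mult)
    qed
    then show ?thesis by (simp add: algebra_simps)
  qed
  have dP: "(P has_real_derivative 0) (at x within {p..q})" if x: "x \<in> {p..q}" for x
    unfolding has_field_derivative_def has_derivative_within_alt
  proof (intro conjI allI impI)
    fix e :: real assume "e > 0"
    then obtain d where d: "d > 0" "\<And>y. y \<in> {p..q} \<Longrightarrow> \<bar>y - x\<bar> < d \<Longrightarrow> \<bar>A y - A x\<bar> < e / (2 * C)"
      using cA x C(1) unfolding continuous_on_iff dist_real_def
      by (metis zero_less_divide_iff zero_less_mult_iff zero_less_numeral)
    have "norm (P y - P x - 0 * (y - x)) \<le> e * norm (y - x)" if y: "y \<in> {p..q}" "norm (y - x) < d" for y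
    proof -
      have "\<bar>P y - P x\<bar> \<le> 2 * C * \<bar>y - x\<bar> * \<bar>A y - A x\<bar>"
      proof (cases "x \<le> y")
        case True
        then have "\<bar>P y - P x\<bar> \<le> 2 * C * \<bar>y - x\<bar> * (A y - A x)" using est[of x y] x y by auto
        also have "\<dots> \<le> 2 * C * \<bar>y - x\<bar> * \<bar>A y - A x\<bar>" using C by (intro mult_left_mono) auto
        finally show ?thesis .
      next
        case False
        then have "\<bar>P y - P x\<bar> \<le> 2 * C * \<bar>y - x\<bar> * (A x - A y)" using est[of y x] x y by (auto simp: abs_minus_commute)
        also have "\<dots> \<le> 2 * C * \<bar>y - x\<bar> * \<bar>A y - A x\<bar>" using C by (intro mult_left_mono) auto
        finally show ?thesis .
      qed
      also have "\<dots> \<le> 2 * C * \<bar>y - x\<bar> * (e / (2 * C))"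
        using d(2)[of y] y C(1) by (intro mult_left_mono) auto
      also have "\<dots> = e * \<bar>y - x\<bar>" using C(1) by (simp add: field_simps)
      finally show ?thesis by simp
    qed
    then show "\<exists>d>0. \<forall>y\<in>{p..q}. norm (y - x) < d \<longrightarrow> norm (P y - P x - 0 * (y - x)) \<le> e * norm (y - x)"
      using d(1) by blast
  qed (rule bounded_linear_mult_right)
  have "P p = P q"
    using has_field_derivative_zero_constant[of "{p..q}" P] dP \<open>p \<le> q\<close> by force
  then have "integral {p..q} (\<lambda>t. K t * g t + K' t * F t) = K q * F q - K p * F p"
    by (simp add: P_def)
  then show ?thesis
    using integrable_integral[OF int] by metis
qed

text \<open>\<open>F\<close> is only absolutely continuous, so the first integration by parts is the
  preceding lemma; the second is the classical product rule for \<open>K' * w\<close>. The terms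
  \<open>K' * F\<close> cancel. This later moves the fourth derivative onto explicit
  kernels.\<close>

lemma integral_by_parts_twice:
  fixes K K' K'' w F g :: "real \<Rightarrow> real"
  assumes "p \<le> q" and g: "g absolutely_integrable_on {p..q}"
    and F: "\<And>x y. p \<le> x \<Longrightarrow> x \<le> y \<Longrightarrow> y \<le> q \<Longrightarrow> F y - F x = integral {x..y} g"
    and w: "\<And>x. x \<in> {p..q} \<Longrightarrow> (w has_real_derivative F x) (at x within {p..q})"
    and K: "\<And>x. (K has_real_derivative K' x) (at x)"
    and K': "\<And>x. (K' has_real_derivative K'' x) (at x)"
  shows "((\<lambda>t. K t * g t - K'' t * w t) has_integral
      (K q * F q - K' q * w q - (K p * F p - K' p * w p))) {p..q}"
proof -
  have cK': "continuous_on {p..q} K'"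
    using K' by (meson DERIV_isCont continuous_at_imp_continuous_on)
  have 1: "((\<lambda>t. K t * g t + K' t * F t) has_integral (K q * F q - K p * F p)) {p..q}"
    using integral_by_parts_absolutely_continuous[OF assms(1,2) F _ cK'] K
    by (meson has_field_derivative_at_within)
  have 2: "((\<lambda>t. K'' t * w t + K' t * F t) has_integral (K' q * w q - K' p * w p)) {p..q}"
  proof (rule fundamental_theorem_of_calculus[OF \<open>p \<le> q\<close>])
    fix x assume "x \<in> {p..q}"
    then show "((\<lambda>t. K' t * w t) has_vector_derivative K'' x * w x + K' x * F x) (at x within {p..q})"
      using DERIV_mult[OF has_field_derivative_at_within[OF K'] w]
      by (simp add: has_real_derivative_iff_has_vector_derivative[symmetric] algebra_simps)
  qed
  show ?thesis
    using has_integral_diff[OF 1 2] by (simp add: algebra_simps)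
qed

text \<open>A negative value would force, by the mean value theorem, a negative slope to its left
  and a positive one to its right, whereas \<open>f'\<close> cannot increase.\<close>

lemma concave_zero_ends_nonneg:
  fixes f f' f'' :: "real \<Rightarrow> real"
  assumes f: "\<And>x. x \<in> {a..b} \<Longrightarrow> (f has_real_derivative f' x) (at x within {a..b})"
    and f': "\<And>x. x \<in> {a..b} \<Longrightarrow> (f' has_real_derivative f'' x) (at x within {a..b})"
    and le: "\<And>x. x \<in> {a..b} \<Longrightarrow> f'' x \<le> 0"
    and "f a = 0" "f b = 0" and x: "x \<in> {a..b}"
  shows "0 \<le> f x"
proof (rule ccontr)
  assume neg: "\<not> 0 \<le> f x"
  then have ax: "a < x" "x < b"
    using x \<open>f a = 0\<close> \<open>f b = 0\<close> by (auto simp: less_eq_real_def)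
  have mv: "\<exists>z\<in>{c<..<d}. F d - F c = F' z * (d - c)"
    if F: "\<And>x. x \<in> {a..b} \<Longrightarrow> (F has_real_derivative F' x) (at x within {a..b})"
      and cd: "a \<le> c" "c < d" "d \<le> b" for F F' :: "real \<Rightarrow> real" and c d
    using mvt_simple[of c d F "\<lambda>x. (*) (F' x)"] cd
      DERIV_subset[OF F, of _ "{c..d}"] unfolding has_field_derivative_def by auto
  obtain y where y: "a < y" "y < x" "f x - f a = f' y * (x - a)"
    using mv[of f f' a x, OF f] ax by auto
  obtain z where z: "x < z" "z < b" "f b - f x = f' z * (b - x)"
    using mv[of f f' x b, OF f] ax by auto
  have "f' y < 0" using y neg \<open>f a = 0\<close> by (simp add: not_le mult_less_0_iff)
  moreover have "f' z > 0" using z neg \<open>f b = 0\<close> zero_less_mult_pos2[of "f' z" "b - x"] by simp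
  moreover have "f' z \<le> f' y"
  proof -
    obtain t where t: "y < t" "t < z" "f' z - f' y = f'' t * (z - y)"
      using mv[of f' f'' y z, OF f'] y z ax by auto
    have "f'' t \<le> 0" using le[of t] t y z by auto
    then have "f'' t * (z - y) \<le> 0" using t by (simp add: mult_nonpos_nonneg)
    then show ?thesis using t by simp
  qed
  ultimately show False by simp
qed

section \<open>The maximum principle\<close>

text \<open>
  The denominator of \<^const>\<open>sigma\<close> is positive because otherwise the bound would contradict \<open>N > 0\<close>.
\<close>

lemma sigma_bound_imp_corner_condition:
  fixes L m N :: real
  assumes "L > 0" "m > 0" "N > 0" and N: "N \<le> 4 * m\<^sup>2 / L^3 * sigma (m * L)"
  defines "q \<equiv> (cosh (m * L) - 1) / sinh (m * L)"
  shows "N * (cosh (m * L) - 1) * (L / (2 * m\<^sup>2) - q / m^3)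
    \<le> m\<^sup>2 * (1 + N * (L^3 / (12 * m\<^sup>2) - L / m^4 + 2 * q / m^5))"
proof -
  define t where "t = m * L"
  define C S where "C = cosh t" and "S = sinh t"
  define D where "D = 6 * t * C + 6 * t - 12 * S - t^3"
  have t: "t > 0" using assms by (simp add: t_def)
  have S: "S > 0" using t by (simp add: S_def)
  \<comment> \<open>Here \<open>q\<close> is \<open>tanh (t / 2)\<close>; the identity eliminates it
    from the combination below.\<close>
  have qC: "q * (C + 1) = S"
  proof -
    have "(C - 1) * (C + 1) = S * S"
      using cosh_square_eq[of t] by (simp add: C_def S_def power2_eq_square algebra_simps)
    then show ?thesis using S by (simp add: q_def C_def S_def t_def field_simps)
  qed
  have sig: "sigma t = 3 * t^3 / D" by (simp add: sigma_def D_def C_def S_def)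
  have "0 < 4 * m\<^sup>2 / L^3 * sigma t" using N \<open>N > 0\<close> by (simp add: t_def)
  moreover have "0 < 4 * m\<^sup>2 / L^3" using assms by simp
  ultimately have "0 < sigma t" by (metis zero_less_mult_pos)
  then have D: "D > 0" using t unfolding sig by (simp add: zero_less_divide_iff)
  have "N \<le> 12 * m\<^sup>2 * t^3 / (L^3 * D)" using N unfolding t_def[symmetric] sig by (simp add: mult.assoc)
  then have "N * D \<le> 12 * m\<^sup>2 * t^3 / L^3" using D \<open>L > 0\<close> by (simp add: field_simps)
  also have "\<dots> = 12 * m^5" using \<open>L > 0\<close> by (simp add: t_def field_simps eval_nat_numeral)
  finally have ND: "N * (D / (12 * m^3)) \<le> m\<^sup>2"
    using \<open>m > 0\<close> by (simp add: field_simps eval_nat_numeral)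
  \<comment> \<open>The coefficient of \<open>N\<close> in the difference of the two sides is the
    denominator of \<open>sigma t\<close> divided by \<open>12 * m^3\<close>, so the claim is the
    hypothesis on \<open>N\<close> rearranged.\<close>
  have "(C - 1) * (L / (2 * m\<^sup>2) - q / m^3) - m\<^sup>2 * (L^3 / (12 * m\<^sup>2) - L / m^4 + 2 * q / m^5)
      = (C + 1) * L / (2 * m\<^sup>2) - q * (C + 1) / m^3 - L^3 / 12"
    using \<open>m > 0\<close> by (simp add: field_simps eval_nat_numeral)
  also have "\<dots> = D / (12 * m^3)"
    unfolding qC D_def t_def using \<open>m > 0\<close> by (simp add: field_simps eval_nat_numeral)
  finally have "N * ((C - 1) * (L / (2 * m\<^sup>2) - q / m^3) - m\<^sup>2 * (L^3 / (12 * m\<^sup>2) - L / m^4 + 2 * q / m^5)) \<le> m\<^sup>2"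
    using ND by simp
  moreover have "N * c * v \<le> m\<^sup>2 * (1 + N * w)" if "N * (c * v - m\<^sup>2 * w) \<le> m\<^sup>2" for c v w
    using that by (simp add: algebra_simps)
  ultimately show ?thesis unfolding C_def t_def by blast
qed

lemma nonlocal_beam_maximum_principle_aux:
  fixes u u1 u2 u3 g :: "real \<Rightarrow> real"
  assumes "L > 0" "m > 0" "N > 0" and N: "N \<le> 4 * m\<^sup>2 / L^3 * sigma (m * L)"
    and du: "\<And>x. x \<in> {0..L} \<Longrightarrow> (u has_real_derivative u1 x) (at x within {0..L})"
    and du1: "\<And>x. x \<in> {0..L} \<Longrightarrow> (u1 has_real_derivative u2 x) (at x within {0..L})"
    and du2: "\<And>x. x \<in> {0..L} \<Longrightarrow> (u2 has_real_derivative u3 x) (at x within {0..L})"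
    and g: "g absolutely_integrable_on {0..L}"
    and u3: "\<And>x. x \<in> {0..L} \<Longrightarrow> u3 x = u3 0 + integral {0..x} g"
    and bc: "u 0 = 0" "u L = 0" "u2 0 = 0" "u2 L = 0"
    and h: "\<And>x. x \<in> {0..L} \<Longrightarrow> 0 \<le> g x - m\<^sup>2 * u2 x + N * integral {0..L} u"
    and x: "x \<in> {0..L}"
  shows "u2 x \<le> 0"
proof -
  define k where "k = integral {0..L} u"
  define h where "h t = g t - m\<^sup>2 * u2 t + N * k" for t
  define S C where "S = sinh (m * L)" and "C = cosh (m * L)"
  define q where "q = (C - 1) / S"
  define S1 S2 where "S1 t = sinh (m * t)" and "S2 t = sinh (m * (L - t))" for t
  \<comment> \<open>\<open>E / (m\<^sup>2 S)\<close> solves \<open>- e'' + m\<^sup>2 e = 1\<close> and \<open>\<psi>\<close> solves \<open>- \<psi>'' + m\<^sup>2 \<psi> = \<phi>\<close>, both with zero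
      boundary values; testing with \<open>\<phi>\<close> and then \<open>\<psi>\<close> expresses \<open>k\<close> through \<open>h\<close>.\<close>
  define E E' where "E t = S - S1 t - S2 t" and "E' t = m * cosh (m * (L - t)) - m * cosh (m * t)" for t
  define \<phi> where "\<phi> t = t * (L - t) / 2" for t
  define \<psi> \<psi>' \<psi>'' where "\<psi> t = \<phi> t / m\<^sup>2 - E t / (m^4 * S)"
    and "\<psi>' t = (L / 2 - t) / m\<^sup>2 - E' t / (m^4 * S)"
    and "\<psi>'' t = - E t / (m\<^sup>2 * S)" for t
  define \<Psi> where "\<Psi> = L^3 / (12 * m\<^sup>2) - L / m^4 + 2 * q / m^5"
  \<comment> \<open>Slope of \<open>\<psi>\<close> at 0 and, with opposite sign, at
    \<open>L\<close>.\<close>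
  define \<psi>0 where "\<psi>0 = L / (2 * m\<^sup>2) - q / m^3"
  have h0: "0 \<le> h t" if "t \<in> {0..L}" for t
    using h[OF that] by (simp add: h_def k_def)
  have S: "S > 0" using \<open>L > 0\<close> \<open>m > 0\<close> by (simp add: S_def)
  have gi: "g integrable_on {0..L}" using g by (auto simp: absolutely_integrable_on_def)
  have u3d: "u3 t - u3 s = integral {s..t} g" if "0 \<le> s" "s \<le> t" "t \<le> L" for s t
  proof -
    have "integral {0..s} g + integral {s..t} g = integral {0..t} g"
      using that by (intro Henstock_Kurzweil_Integration.integral_combine integrable_on_subinterval[OF gi]) auto
    then show ?thesis using u3[of s] u3[of t] that by simp
  qed
  have cu: "continuous_on {0..L} u" "continuous_on {0..L} u2"
    using du du2 by (meson DERIV_continuous continuous_on_eq_continuous_within)+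
  have hab: "h absolutely_integrable_on {0..L}"
    unfolding h_def
    by (intro set_integral_add set_integral_diff g absolutely_integrable_continuous_real continuous_intros cu)
  have Kh: "(\<lambda>t. K t * h t) integrable_on {s..t}" if "continuous_on {0..L} K" "0 \<le> s" "t \<le> L" for K s t
    using integrable_on_subinterval[of "\<lambda>t. K t * h t" "{0..L}" s t]
      absolutely_integrable_continuous_mult[OF that(1) hab] that
    by (auto simp: absolutely_integrable_on_def)

  \<comment> \<open>Signs and tangent bounds of the auxiliary functions \<open>E\<close> and
    \<open>\<psi>\<close>\<close>
  have dE: "(E has_real_derivative E' t) (at t)" for t
    unfolding E_def E'_def S1_def S2_def by (auto intro!: derivative_eq_intros)
  have dE': "(E' has_real_derivative - m\<^sup>2 * (S1 t + S2 t)) (at t)" for t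
    unfolding E'_def S1_def S2_def
    by (auto intro!: derivative_eq_intros simp: power2_eq_square algebra_simps)
  have S12: "0 \<le> S1 t + S2 t" if "t \<in> {0..L}" for t
    using that \<open>m > 0\<close> by (auto simp: S1_def S2_def)
  have E0: "E t \<ge> 0" if t: "t \<in> {0..L}" for t
  proof (rule concave_zero_ends_nonneg[where f=E and f'=E' and f''="\<lambda>t. - m\<^sup>2 * (S1 t + S2 t)" and a=0 and b=L])
    show "E 0 = 0" "E L = 0" by (auto simp: E_def S1_def S2_def S_def)
    show "- m\<^sup>2 * (S1 y + S2 y) \<le> 0" if "y \<in> {0..L}" for y
      using S12[OF that] by (simp add: mult_nonneg_nonneg)
  qed (use t dE dE' in \<open>auto intro: has_field_derivative_at_within\<close>)
  \<comment> \<open>A concave function lies below its tangents; the two bounds are the tangents at 0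
    and at \<open>L\<close>.\<close>
  have Etan: "E t \<le> m * (C - 1) * t" "E t \<le> m * (C - 1) * (L - t)" if t: "t \<in> {0..L}" for t
  proof -
    have *: "E t \<le> E y + E' y * (t - y)" if y: "y \<in> {0..L}" for y
      using f''_imp_f'[of "{0..L}" "\<lambda>t. - E t" "\<lambda>t. - E' t" "\<lambda>t. m\<^sup>2 * (S1 t + S2 t)" y t]
        t y S12 DERIV_minus[OF dE] DERIV_minus[OF dE'] by (simp add: left_diff_distrib' right_diff_distrib')
    show "E t \<le> m * (C - 1) * t" "E t \<le> m * (C - 1) * (L - t)"
      using *[of 0] *[of L] \<open>L > 0\<close> by (auto simp: E_def E'_def S1_def S2_def S_def C_def algebra_simps)
  qed
  have d\<psi>: "(\<psi> has_real_derivative \<psi>' t) (at t)" for t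
    unfolding \<psi>_def \<psi>'_def \<phi>_def using S \<open>m > 0\<close>
    by (auto intro!: derivative_eq_intros dE simp: field_simps)
  have d\<psi>': "(\<psi>' has_real_derivative \<psi>'' t) (at t)" for t
  proof -
    have "(\<psi>' has_real_derivative (- 1 / m\<^sup>2 - (- m\<^sup>2 * (S1 t + S2 t)) / (m^4 * S))) (at t)"
      unfolding \<psi>'_def using S \<open>m > 0\<close>
      by (intro DERIV_diff DERIV_cdivide dE') (auto intro!: derivative_eq_intros)
    also have "- 1 / m\<^sup>2 - (- m\<^sup>2 * (S1 t + S2 t)) / (m^4 * S) = \<psi>'' t"
      unfolding \<psi>''_def E_def using S \<open>m > 0\<close> by (simp add: field_simps eval_nat_numeral)
    finally show ?thesis .
  qed
  have \<psi>''0: "\<psi>'' t \<le> 0" if "t \<in> {0..L}" for t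
    using E0[OF that] S by (simp add: \<psi>''_def)
  have \<psi>ends: "\<psi> 0 = 0" "\<psi> L = 0" "\<psi>' 0 = \<psi>0" "\<psi>' L = - \<psi>0"
  proof -
    have ends: "E 0 = 0" "E L = 0" "E' 0 = m * (C - 1)" "E' L = - (m * (C - 1))"
      by (auto simp: E_def E'_def S1_def S2_def S_def C_def algebra_simps)
    show "\<psi> 0 = 0" "\<psi> L = 0" "\<psi>' 0 = \<psi>0" "\<psi>' L = - \<psi>0"
      unfolding \<psi>_def \<psi>'_def \<psi>0_def ends using \<open>m > 0\<close> S by (simp_all add: \<phi>_def q_def field_simps eval_nat_numeral)
  qed
  have \<psi>pos: "\<psi> t \<ge> 0" if t: "t \<in> {0..L}" for t
    by (rule concave_zero_ends_nonneg[where f=\<psi> and f'=\<psi>' and f''=\<psi>'' and a=0 and b=L])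
      (use t d\<psi> d\<psi>' \<psi>''0 \<psi>ends in \<open>auto intro: has_field_derivative_at_within\<close>)
  have \<psi>tan: "\<psi> t \<le> \<psi>0 * t" "\<psi> t \<le> \<psi>0 * (L - t)" if t: "t \<in> {0..L}" for t
  proof -
    have *: "\<psi> t \<le> \<psi> y + \<psi>' y * (t - y)" if y: "y \<in> {0..L}" for y
      using f''_imp_f'[of "{0..L}" "\<lambda>t. - \<psi> t" "\<lambda>t. - \<psi>' t" "\<lambda>t. - \<psi>'' t" y t]
        t y \<psi>''0 DERIV_minus[OF d\<psi>] DERIV_minus[OF d\<psi>'] by (simp add: algebra_simps)
    show "\<psi> t \<le> \<psi>0 * t" "\<psi> t \<le> \<psi>0 * (L - t)"
      using *[of 0] *[of L] \<open>L > 0\<close> \<psi>ends by (auto simp: algebra_simps)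
  qed
  have \<psi>00: "\<psi>0 \<ge> 0"
  proof -
    have "0 \<le> \<psi>0 * L" using \<psi>tan(1)[of L] \<psi>pos[of L] \<open>L > 0\<close> by simp
    then show ?thesis using \<open>L > 0\<close> by (simp add: zero_le_mult_iff)
  qed
  have \<psi>int: "(\<psi> has_integral \<Psi>) {0..L}"
  proof -
    define P where "P t = (L * t\<^sup>2 / 4 - t^3 / 6) / m\<^sup>2
        - (t * S - cosh (m * t) / m + cosh (m * (L - t)) / m) / (m^4 * S)" for t
    have "(\<psi> has_integral (P L - P 0)) {0..L}"
    proof (rule fundamental_theorem_of_calculus)
      fix t assume "t \<in> {0..L}"
      have "(P has_real_derivative \<psi> t) (at t within {0..L})"
        unfolding P_def \<psi>_def \<phi>_def E_def S1_def S2_def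
        by (rule derivative_eq_intros refl | use S \<open>m > 0\<close> in \<open>simp add: field_simps power2_eq_square\<close>)+
      then show "(P has_vector_derivative \<psi> t) (at t within {0..L})"
        by (simp add: has_real_derivative_iff_has_vector_derivative)
    qed (use \<open>L > 0\<close> in simp)
    also have "P L - P 0 = \<Psi>"
      unfolding P_def \<Psi>_def q_def using S \<open>m > 0\<close>
      by (simp add: field_simps eval_nat_numeral C_def)
    finally show ?thesis .
  qed
  have \<Psi>0: "\<Psi> \<ge> 0" using has_integral_nonneg[OF \<psi>int] \<psi>pos by auto

  \<comment> \<open>The integral \<open>k\<close> of \<open>u\<close> in terms of
    \<open>h\<close>\<close>
  have ku: "(u has_integral k) {0..L}"
    unfolding k_def using cu integrable_continuous_interval by blast
  \<comment> \<open>Because \<open>\<phi>'' = -1\<close>, the integrand is the derivative of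
    \<open>\<phi> * u1 - \<phi>' * u\<close>, which vanishes at both ends; hence \<open>u2\<close>
    tested with \<open>\<phi>\<close> gives \<open>- k\<close>.\<close>
  have "((\<lambda>t. \<phi> t * u2 t + u t) has_integral
      ((\<phi> L * u1 L - (L / 2 - L) * u L) - (\<phi> 0 * u1 0 - (L / 2 - 0) * u 0))) {0..L}"
  proof (rule fundamental_theorem_of_calculus)
    fix t assume t: "t \<in> {0..L}"
    have "((\<lambda>t. \<phi> t * u1 t - (L / 2 - t) * u t) has_real_derivative \<phi> t * u2 t + u t) (at t within {0..L})"
      unfolding \<phi>_def by (rule derivative_eq_intros refl du[OF t] du1[OF t] | simp add: field_simps)+
    then show "((\<lambda>t. \<phi> t * u1 t - (L / 2 - t) * u t) has_vector_derivative \<phi> t * u2 t + u t) (at t within {0..L})"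
      by (simp add: has_real_derivative_iff_has_vector_derivative)
  qed (use \<open>L > 0\<close> in simp)
  then have "((\<lambda>t. \<phi> t * u2 t + u t) has_integral 0) {0..L}"
    by (simp add: bc \<phi>_def)
  from has_integral_diff[OF this ku] have \<phi>u: "((\<lambda>t. \<phi> t * u2 t) has_integral - k) {0..L}"
    by simp
  have ibp\<psi>: "((\<lambda>t. \<psi> t * g t - \<psi>'' t * u2 t) has_integral 0) {0..L}"
    using integral_by_parts_twice[where p=0 and q=L and K=\<psi> and K'=\<psi>' and K''=\<psi>'' and g=g and F=u3 and w=u2]
      \<open>L > 0\<close> g u3d du2 d\<psi> d\<psi>' by (simp add: \<psi>ends bc)
  \<comment> \<open>The equation \<open>\<psi>'' - m\<^sup>2 * \<psi> = - \<phi>\<close> reduces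
    this to the two preceding integrals, which contribute 0 and \<open>k\<close>; the nonlocal term
    adds \<open>N * k * \<Psi>\<close>.\<close>
  have \<psi>h: "((\<lambda>t. \<psi> t * h t) has_integral k * (1 + N * \<Psi>)) {0..L}"
  proof -
    have eq: "\<psi> t * h t = (\<psi> t * g t - \<psi>'' t * u2 t) - \<phi> t * u2 t + N * k * \<psi> t" for t
    proof -
      have "\<psi>'' t - m\<^sup>2 * \<psi> t = - \<phi> t"
        unfolding \<psi>''_def \<psi>_def using S \<open>m > 0\<close> by (simp add: field_simps eval_nat_numeral)
      then have *: "\<psi>'' t = m\<^sup>2 * \<psi> t - \<phi> t" by simp
      show ?thesis unfolding h_def * by (simp add: algebra_simps)
    qed
    have "((\<lambda>t. (\<psi> t * g t - \<psi>'' t * u2 t) - \<phi> t * u2 t + N * k * \<psi> t) has_integral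
        (0 - (- k) + N * k * \<Psi>)) {0..L}"
      by (intro has_integral_add has_integral_diff ibp\<psi> \<phi>u has_integral_mult_right \<psi>int)
    then show ?thesis by (simp add: eq algebra_simps)
  qed

  \<comment> \<open>Green representation of \<open>u2 x\<close>\<close>
  define R1 R2 where "R1 = integral {0..x} (\<lambda>t. t * h t)" and "R2 = integral {x..L} (\<lambda>t. (L - t) * h t)"
  \<comment> \<open>The two halves of the Green integral of \<open>h\<close>, without the outer
    factors \<open>S2 x\<close> and \<open>S1 x\<close>. \<open>R1\<close> and \<open>R2\<close> are
    the same halves with \<open>sinh\<close> replaced by its argument and the factor
    \<open>m\<close> dropped.\<close>
  define I1 I2 where "I1 = integral {0..x} (\<lambda>t. S1 t * h t)" and "I2 = integral {x..L} (\<lambda>t. S2 t * h t)"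
  have cS: "continuous_on {0..L} S1" "continuous_on {0..L} S2" "continuous_on {0..L} \<psi>"
    unfolding S1_def S2_def \<psi>_def \<phi>_def E_def using S \<open>m > 0\<close> by (auto intro!: continuous_intros)
  have x': "0 \<le> x" "x \<le> L" using x by auto
  \<comment> \<open>\<open>S1\<close> solves \<open>v'' = m\<^sup>2 * v\<close>, so integrating by
    parts twice leaves only boundary terms, and those at 0 vanish because \<open>S1 0 = 0\<close>
    and \<open>u2 0 = 0\<close>. \<open>I2\<close> is the mirror image at \<open>L\<close>.\<close>
  have I1: "I1 = S1 x * u3 x - m * cosh (m * x) * u2 x + N * k * ((cosh (m * x) - 1) / m)"
  proof -
    have 1: "((\<lambda>t. S1 t * g t - m\<^sup>2 * S1 t * u2 t) has_integral
        (S1 x * u3 x - m * cosh (m * x) * u2 x - (S1 0 * u3 0 - m * cosh (m * 0) * u2 0))) {0..x}"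
    proof (rule integral_by_parts_twice)
      show "(u2 has_real_derivative u3 y) (at y within {0..x})" if "y \<in> {0..x}" for y
        using DERIV_subset[OF du2, of y "{0..x}"] that x by auto
      show "g absolutely_integrable_on {0..x}"
        by (rule absolutely_integrable_on_subinterval[OF g]) (use x in auto)
    qed (use x u3d in \<open>auto simp: S1_def power2_eq_square intro!: derivative_eq_intros\<close>)
    have 2: "(S1 has_integral (cosh (m * x) / m - cosh (m * 0) / m)) {0..x}"
    proof (rule fundamental_theorem_of_calculus)
      show "((\<lambda>a. cosh (m * a) / m) has_vector_derivative S1 y) (at y within {0..x})" for y
        unfolding has_real_derivative_iff_has_vector_derivative[symmetric] S1_def
        using \<open>m > 0\<close> by (auto intro!: derivative_eq_intros)
    qed (use x in auto)
    have "((\<lambda>t. (S1 t * g t - m\<^sup>2 * S1 t * u2 t) + N * k * S1 t) has_integral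
        (S1 x * u3 x - m * cosh (m * x) * u2 x - (S1 0 * u3 0 - m * cosh (m * 0) * u2 0))
         + N * k * (cosh (m * x) / m - cosh (m * 0) / m)) {0..x}"
      by (intro has_integral_add 1 2 has_integral_mult_right)
    moreover have "(\<lambda>t. (S1 t * g t - m\<^sup>2 * S1 t * u2 t) + N * k * S1 t) = (\<lambda>t. S1 t * h t)"
      by (auto simp: h_def algebra_simps)
    ultimately show ?thesis
      unfolding I1_def by (simp add: integral_unique S1_def bc diff_divide_distrib)
  qed
  have I2: "I2 = - S2 x * u3 x - m * cosh (m * (L - x)) * u2 x + N * k * ((cosh (m * (L - x)) - 1) / m)"
  proof -
    have 1: "((\<lambda>t. S2 t * g t - m\<^sup>2 * S2 t * u2 t) has_integral
        (S2 L * u3 L - (- m * cosh (m * (L - L))) * u2 L - (S2 x * u3 x - (- m * cosh (m * (L - x))) * u2 x))) {x..L}"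
    proof (rule integral_by_parts_twice)
      show "(u2 has_real_derivative u3 y) (at y within {x..L})" if "y \<in> {x..L}" for y
        using DERIV_subset[OF du2, of y "{x..L}"] that x by auto
      show "g absolutely_integrable_on {x..L}"
        by (rule absolutely_integrable_on_subinterval[OF g]) (use x in auto)
    qed (use x u3d in \<open>auto simp: S2_def power2_eq_square intro!: derivative_eq_intros\<close>)
    have 2: "(S2 has_integral (- cosh (m * (L - L)) / m - (- cosh (m * (L - x)) / m))) {x..L}"
    proof (rule fundamental_theorem_of_calculus)
      show "((\<lambda>a. - cosh (m * (L - a)) / m) has_vector_derivative S2 y) (at y within {x..L})" for y
        unfolding has_real_derivative_iff_has_vector_derivative[symmetric] S2_def
        using \<open>m > 0\<close> by (auto intro!: derivative_eq_intros)
    qed (use x in auto)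
    have "((\<lambda>t. (S2 t * g t - m\<^sup>2 * S2 t * u2 t) + N * k * S2 t) has_integral
        (S2 L * u3 L - (- m * cosh (m * (L - L))) * u2 L - (S2 x * u3 x - (- m * cosh (m * (L - x))) * u2 x))
         + N * k * (- cosh (m * (L - L)) / m - (- cosh (m * (L - x)) / m))) {x..L}"
      by (intro has_integral_add 1 2 has_integral_mult_right)
    moreover have "(\<lambda>t. (S2 t * g t - m\<^sup>2 * S2 t * u2 t) + N * k * S2 t) = (\<lambda>t. S2 t * h t)"
      by (auto simp: h_def algebra_simps)
    ultimately show ?thesis
      unfolding I2_def by (simp add: integral_unique S2_def bc diff_divide_distrib)
  qed
  \<comment> \<open>This is integration of \<open>h\<close> against \<open>m S\<close> times the Dirichlet Green function of \<open>- d\<^sup>2 + m\<^sup>2\<close>.\<close>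
  have green: "S2 x * I1 + S1 x * I2 = - m * S * u2 x + N * k / m * E x"
  proof -
    have Sadd: "S = S1 x * cosh (m * (L - x)) + cosh (m * x) * S2 x"
      using sinh_add[of "m * x" "m * (L - x)"] by (simp add: S_def S1_def S2_def algebra_simps)
    have "S2 x * I1 + S1 x * I2 = - m * (S1 x * cosh (m * (L - x)) + cosh (m * x) * S2 x) * u2 x
        + N * k / m * (S1 x * cosh (m * (L - x)) + cosh (m * x) * S2 x - S1 x - S2 x)"
      unfolding I1 I2 using \<open>m > 0\<close> by (simp add: field_simps)
    then show ?thesis unfolding E_def Sadd[symmetric] .
  qed

  \<comment> \<open>Comparison of the Green term with the nonlocal term\<close>
  have Kh_mono: "integral {s..t} (\<lambda>y. K y * h y) \<le> integral {s..t} (\<lambda>y. K' y * h y)"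
    if "continuous_on {0..L} K" "continuous_on {0..L} K'" "0 \<le> s" "t \<le> L" "\<And>y. y \<in> {s..t} \<Longrightarrow> K y \<le> K' y" for K K' s t
    using that by (intro integral_le Kh mult_right_mono h0) auto
  have R0: "R1 \<ge> 0" "R2 \<ge> 0"
  proof -
    have "integral {0..x} (\<lambda>t. 0 * h t) \<le> R1"
      unfolding R1_def by (rule Kh_mono) (use x in \<open>auto intro!: continuous_intros\<close>)
    then show "R1 \<ge> 0" by simp
    have "integral {x..L} (\<lambda>t. 0 * h t) \<le> R2"
      unfolding R2_def by (rule Kh_mono) (use x in \<open>auto intro!: continuous_intros\<close>)
    then show "R2 \<ge> 0" by simp
  qed
  have sinh_ge: "t \<le> sinh t" if "t \<ge> 0" for t :: real
  proof -
    have "(\<lambda>t. sinh t - t) 0 \<le> (\<lambda>t. sinh t - t) t"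
    proof (rule DERIV_nonneg_imp_nondecreasing[OF that])
      fix y :: real
      have "((\<lambda>t. sinh t - t) has_real_derivative (cosh y - 1)) (at y)"
        by (auto intro!: derivative_eq_intros)
      then show "\<exists>z. ((\<lambda>t. sinh t - t) has_real_derivative z) (at y) \<and> 0 \<le> z"
        using cosh_real_ge_1[of y] by (intro exI[of _ "cosh y - 1"]) auto
    qed
    then show ?thesis by simp
  qed
  have I1R: "I1 \<ge> m * R1"
  proof -
    have "integral {0..x} (\<lambda>t. (m * t) * h t) \<le> I1"
      unfolding I1_def by (rule Kh_mono) (use x sinh_ge \<open>m > 0\<close> cS in \<open>auto simp: S1_def intro!: continuous_intros\<close>)
    then show ?thesis by (simp add: R1_def mult.assoc)
  qed
  have I2R: "I2 \<ge> m * R2"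
  proof -
    have "integral {x..L} (\<lambda>t. (m * (L - t)) * h t) \<le> I2"
      unfolding I2_def by (rule Kh_mono) (use x sinh_ge \<open>m > 0\<close> cS in \<open>auto simp: S2_def intro!: continuous_intros\<close>)
    then show ?thesis by (simp add: R2_def mult.assoc)
  qed
  \<comment> \<open>Split at \<open>x\<close>: on the left \<open>\<psi>\<close> is bounded by its
    tangent at 0, on the right by its tangent at \<open>L\<close>.\<close>
  have Q: "k * (1 + N * \<Psi>) \<le> \<psi>0 * R1 + \<psi>0 * R2"
  proof -
    have "k * (1 + N * \<Psi>) = integral {0..x} (\<lambda>t. \<psi> t * h t) + integral {x..L} (\<lambda>t. \<psi> t * h t)"
      using integral_unique[OF \<psi>h] Henstock_Kurzweil_Integration.integral_combine[OF x' Kh[OF cS(3), of 0 L]] by simp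
    moreover have "integral {0..x} (\<lambda>t. \<psi> t * h t) \<le> integral {0..x} (\<lambda>t. (\<psi>0 * t) * h t)"
      by (rule Kh_mono) (use x \<psi>tan cS in \<open>auto intro!: continuous_intros\<close>)
    moreover have "integral {x..L} (\<lambda>t. \<psi> t * h t) \<le> integral {x..L} (\<lambda>t. (\<psi>0 * (L - t)) * h t)"
      by (rule Kh_mono) (use x \<psi>tan cS in \<open>auto intro!: continuous_intros\<close>)
    ultimately show ?thesis by (simp add: R1_def R2_def mult.assoc)
  qed
  \<comment> \<open>A common measure for both terms: \<open>m\<^sup>2 * R\<close> bounds the Green
    term from below, \<open>m * (C - 1) * \<psi>0 * R\<close> the nonlocal one from above. In the
    latter the tangents of \<open>E\<close> are crossed: the one at \<open>L\<close> goes with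
    \<open>R1\<close>, the one at 0 with \<open>R2\<close>.\<close>
  define R where "R = (L - x) * R1 + x * R2"
  have R00: "R \<ge> 0" using R0 x by (simp add: R_def)
  have G: "m\<^sup>2 * R \<le> S2 x * I1 + S1 x * I2"
  proof -
    have "m * (L - x) * (m * R1) \<le> S2 x * I1"
      using I1R R0 x sinh_ge \<open>m > 0\<close> by (intro mult_mono) (auto simp: S2_def)
    moreover have "m * x * (m * R2) \<le> S1 x * I2"
      using I2R R0 x sinh_ge \<open>m > 0\<close> by (intro mult_mono) (auto simp: S1_def)
    ultimately show ?thesis by (simp add: R_def power2_eq_square algebra_simps)
  qed
  have EQ: "E x * (k * (1 + N * \<Psi>)) \<le> m * (C - 1) * \<psi>0 * R"
  proof -
    have "E x * (k * (1 + N * \<Psi>)) \<le> E x * (\<psi>0 * R1 + \<psi>0 * R2)"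
      using Q E0[OF x] by (rule mult_left_mono)
    also have "\<dots> = E x * (\<psi>0 * R1) + E x * (\<psi>0 * R2)" by (simp add: algebra_simps)
    also have "\<dots> \<le> m * (C - 1) * (L - x) * (\<psi>0 * R1) + m * (C - 1) * x * (\<psi>0 * R2)"
      using Etan[OF x] \<psi>00 R0 by (intro add_mono mult_right_mono) auto
    also have "\<dots> = m * (C - 1) * \<psi>0 * R" by (simp add: R_def algebra_simps)
    finally show ?thesis .
  qed
  have cond: "N * (C - 1) * \<psi>0 \<le> m\<^sup>2 * (1 + N * \<Psi>)"
    using sigma_bound_imp_corner_condition[OF assms(1-4)]
    by (simp add: \<psi>0_def \<Psi>_def q_def C_def S_def)
  have pos: "1 + N * \<Psi> > 0" using \<Psi>0 \<open>N > 0\<close> by (simp add: add_pos_nonneg)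
  \<comment> \<open>Everything is multiplied by \<open>1 + N * \<Psi>\<close> so that
    \<open>k\<close> enters only through \<open>k * (1 + N * \<Psi>)\<close>. Both ends of the chain
    contain \<open>N * (C - 1) * \<psi>0 * R\<close>; cancelling it leaves the sign of
    \<open>u2 x\<close>.\<close>
  have "N * (C - 1) * \<psi>0 * R \<le> m\<^sup>2 * (1 + N * \<Psi>) * R"
    using cond R00 by (rule mult_right_mono)
  also have "\<dots> \<le> (1 + N * \<Psi>) * (S2 x * I1 + S1 x * I2)"
    using mult_left_mono[OF G less_imp_le[OF pos]] by (simp add: algebra_simps)
  also have "\<dots> = - m * S * u2 x * (1 + N * \<Psi>) + N / m * (E x * (k * (1 + N * \<Psi>)))"
    unfolding green by (simp add: algebra_simps add_divide_distrib)
  also have "\<dots> \<le> - m * S * u2 x * (1 + N * \<Psi>) + N / m * (m * (C - 1) * \<psi>0 * R)"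
    using EQ \<open>N > 0\<close> \<open>m > 0\<close> by (intro add_left_mono mult_left_mono) auto
  also have "\<dots> = - m * S * u2 x * (1 + N * \<Psi>) + N * (C - 1) * \<psi>0 * R"
    using \<open>m > 0\<close> by simp
  finally have "u2 x * (m * S * (1 + N * \<Psi>)) \<le> 0" by (simp add: algebra_simps)
  then show ?thesis
    using pos S \<open>m > 0\<close> by (simp add: mult_le_0_iff)
qed

text \<open>Reduces to the pointwise version, since altering \<open>g\<close> on the negligible set
  \<open>B\<close> changes no integral. Once \<open>u2 \<le> 0\<close>, the function
  \<open>u\<close> is concave with zero ends, hence nonnegative.\<close>

lemma nonlocal_beam_maximum_principle:
  fixes u u1 u2 u3 g :: "real \<Rightarrow> real"
  assumes "L > 0" "M > 0" "N > 0" and N: "N \<le> 4 * M / L^3 * sigma (sqrt M * L)"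
    and du: "\<And>x. x \<in> {0..L} \<Longrightarrow> (u has_real_derivative u1 x) (at x within {0..L})"
    and du1: "\<And>x. x \<in> {0..L} \<Longrightarrow> (u1 has_real_derivative u2 x) (at x within {0..L})"
    and du2: "\<And>x. x \<in> {0..L} \<Longrightarrow> (u2 has_real_derivative u3 x) (at x within {0..L})"
    and g: "g absolutely_integrable_on {0..L}"
    and u3: "\<And>x. x \<in> {0..L} \<Longrightarrow> u3 x = u3 0 + integral {0..x} g"
    and bc: "u 0 = 0" "u L = 0" "u2 0 = 0" "u2 L = 0"
    and B: "negligible B" "\<And>x. x \<in> {0..L} - B \<Longrightarrow> 0 \<le> g x - M * u2 x + N * integral {0..L} u"
    and x: "x \<in> {0..L}"
  shows "u2 x \<le> 0" "0 \<le> u x"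
proof -
  \<comment> \<open>On \<open>B\<close> the value is chosen so that the operator evaluates to 0
    there.\<close>
  define G where "G t = (if t \<in> B then M * u2 t - N * integral {0..L} u else g t)" for t
  have neg: "u2 y \<le> 0" if y: "y \<in> {0..L}" for y
  proof (rule nonlocal_beam_maximum_principle_aux[where m="sqrt M" and g=G, OF \<open>L > 0\<close> _ \<open>N > 0\<close> _ du du1 du2 _ _ bc _ y])
    show "G absolutely_integrable_on {0..L}"
      by (rule absolutely_integrable_spike[OF g B(1)]) (auto simp: G_def)
    show "u3 y = u3 0 + integral {0..y} G" if "y \<in> {0..L}" for y
    proof -
      have "integral {0..y} G = integral {0..y} g"
        by (rule integral_spike[OF B(1)]) (auto simp: G_def)
      then show ?thesis using u3[OF that] by metis
    qed
  qed (use \<open>M > 0\<close> N B in \<open>auto simp: G_def\<close>)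
  then show "u2 x \<le> 0" using x by blast
  show "0 \<le> u x"
    by (rule concave_zero_ends_nonneg[OF du du1 neg bc(1,2) x])
qed

section \<open>Functions in W41 and their comparison\<close>

lemma d1_eqI:
  assumes "L > 0" "x \<in> {0..L}" "(f has_real_derivative y) (at x within {0..L})"
  shows "d1 L f x = y"
  using assms vector_derivative_within_closed_interval[of 0 L x f y]
  by (simp add: d1_def has_real_derivative_iff_has_vector_derivative)

lemma differentiable_imp_has_d1:
  assumes "f differentiable (at x within {0..L})"
  shows "(f has_real_derivative d1 L f x) (at x within {0..L})"
  using assms unfolding d1_def has_real_derivative_iff_has_vector_derivative vector_derivative_works .

lemma has_real_derivative_cong_on:
  assumes "(f has_real_derivative y) (at x within S)" "x \<in> S" "\<And>t. t \<in> S \<Longrightarrow> f t = g t"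
  shows "(g has_real_derivative y) (at x within S)"
  using assms by (auto intro: has_field_derivative_transform_within[where d=1])

text \<open>Links the form used in the definitions with the exceptional sets used for integrals: the
  endpoints join the negligible set, and \<open>lborel\<close> is exchanged with its
  completion.\<close>

lemma AE_lborel_interval_iff_negligible:
  "(AE x in lborel. x \<in> {0<..<L::real} \<longrightarrow> P x) \<longleftrightarrow> (\<exists>B. negligible B \<and> (\<forall>x\<in>{0..L} - B. P x))"
proof
  assume "AE x in lborel. x \<in> {0<..<L} \<longrightarrow> P x"
  then have "AE x in lebesgue. x \<in> {0<..<L} \<longrightarrow> P x" by (rule AE_completion)
  then obtain B where B: "B \<in> null_sets lebesgue" "{x \<in> space lebesgue. \<not> (x \<in> {0<..<L} \<longrightarrow> P x)} \<subseteq> B"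
    unfolding eventually_ae_filter by blast
  have "negligible B" using B(1) negligible_iff_null_sets by blast
  then have "negligible (B \<union> {0, L})" by (simp add: negligible_finite)
  moreover have "P x" if "x \<in> {0..L} - (B \<union> {0, L})" for x
    using that B(2) by (auto simp: less_eq_real_def)
  ultimately show "\<exists>B. negligible B \<and> (\<forall>x\<in>{0..L} - B. P x)" by blast
next
  assume "\<exists>B. negligible B \<and> (\<forall>x\<in>{0..L} - B. P x)"
  then obtain B where B: "negligible B" "\<forall>x\<in>{0..L} - B. P x" by blast
  then have "AE x in lebesgue. x \<in> {0<..<L} \<longrightarrow> P x"
    unfolding eventually_ae_filter negligible_iff_null_sets by (intro bexI[of _ B]) auto
  then show "AE x in lborel. x \<in> {0<..<L} \<longrightarrow> P x" by (simp add: AE_completion_iff)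
qed

lemma W41_derivatives:
  assumes "W41 L w" "x \<in> {0..L}"
  shows "(w has_real_derivative d1 L w x) (at x within {0..L})"
    and "(d1 L w has_real_derivative d2 L w x) (at x within {0..L})"
    and "(d2 L w has_real_derivative d3 L w x) (at x within {0..L})"
  using assms differentiable_imp_has_d1 unfolding W41_def d3_def d2_def by blast+

lemma W41_continuous:
  assumes "W41 L w"
  shows "continuous_on {0..L} w" "continuous_on {0..L} (d1 L w)" "continuous_on {0..L} (d2 L w)"
  unfolding continuous_on_eq_continuous_within
  using DERIV_continuous[OF W41_derivatives(1)[OF assms]] DERIV_continuous[OF W41_derivatives(2)[OF assms]]
    DERIV_continuous[OF W41_derivatives(3)[OF assms]] by blast+

lemma W41_imp_C2:
  assumes "W41 L w"
  shows "C2 L w"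
  using assms W41_continuous(3)[OF assms] by (auto simp: W41_def C2_def)

text \<open>\<open>d4\<close> is a pointwise derivative, \<open>g\<close> a density of
  \<open>d3\<close>; almost everywhere differentiation of the indefinite integral identifies
  them.\<close>

lemma d4_eq_negligible:
  assumes "L > 0" and g: "g absolutely_integrable_on {0..L}"
    and d3: "\<And>x. x \<in> {0..L} \<Longrightarrow> d3 L w x = k + integral {0..x} g"
  shows "negligible {x\<in>{0..L}. d4 L w x \<noteq> g x}"
proof -
  have gi: "g integrable_on {0..L}" using g by (auto simp: absolutely_integrable_on_def)
  have "d4 L w x = g x"
    if x: "x \<in> {0..L}" and D: "((\<lambda>x. integral {0..x} g) has_real_derivative g x) (at x within {0..L})" for x
    unfolding d4_def
  proof (rule d1_eqI[OF \<open>L > 0\<close> x])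
    have "((\<lambda>x. k + integral {0..x} g) has_real_derivative g x) (at x within {0..L})"
      by (auto intro!: derivative_eq_intros D)
    then show "(d3 L w has_real_derivative g x) (at x within {0..L})"
      by (rule has_real_derivative_cong_on) (use x d3 in auto)
  qed
  then show ?thesis
    by (intro negligible_subset[OF integral_has_real_derivative_AE[OF gi]]) auto
qed

lemma W41_fourth_derivative:
  assumes "L > 0" "W41 L w"
  obtains g where "g absolutely_integrable_on {0..L}"
    "\<And>x. x \<in> {0..L} \<Longrightarrow> d3 L w x = d3 L w 0 + integral {0..x} g"
    "negligible {x\<in>{0..L}. d4 L w x \<noteq> g x}"
  using assms d4_eq_negligible[OF assms(1)] unfolding W41_def by blast

text \<open>The order in which the iteration is monotone; \<open>in_order_interval\<close> amounts
  to \<open>C2\<close> and two instances of it.\<close>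

definition bend_le :: "real \<Rightarrow> (real \<Rightarrow> real) \<Rightarrow> (real \<Rightarrow> real) \<Rightarrow> bool" where
  "bend_le L u v \<longleftrightarrow> (\<forall>x\<in>{0..L}. u x \<le> v x \<and> d2 L v x \<le> d2 L u x)"

lemma bend_le_refl: "bend_le L u u"
  by (simp add: bend_le_def)

lemma bend_le_trans: "bend_le L u v \<Longrightarrow> bend_le L v w \<Longrightarrow> bend_le L u w"
  by (force simp: bend_le_def)

text \<open>By linearity, the maximum principle applies to \<open>z - y\<close>, with the difference
  of the densities of \<open>d3 L z\<close> and \<open>d3 L y\<close> in the role of the fourth
  derivative.\<close>

lemma beam_comparison:
  assumes "L > 0" "M > 0" "N > 0" "N \<le> 4 * M / L^3 * sigma (sqrt M * L)"
    and y: "W41 L y" "bc L y" and z: "W41 L z" "bc L z"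
    and le: "AE x in lborel. x \<in> {0<..<L} \<longrightarrow>
      d4 L y x - M * d2 L y x + N * integral {0..L} y \<le> d4 L z x - M * d2 L z x + N * integral {0..L} z"
  shows "bend_le L y z"
proof -
  obtain B where B: "negligible B" "\<forall>x\<in>{0..L} - B.
      d4 L y x - M * d2 L y x + N * integral {0..L} y \<le> d4 L z x - M * d2 L z x + N * integral {0..L} z"
    using le unfolding AE_lborel_interval_iff_negligible by blast
  obtain g where g: "g absolutely_integrable_on {0..L}"
    "\<And>x. x \<in> {0..L} \<Longrightarrow> d3 L y x = d3 L y 0 + integral {0..x} g"
    "negligible {x\<in>{0..L}. d4 L y x \<noteq> g x}"
    using W41_fourth_derivative[OF \<open>L > 0\<close> y(1)] by blast
  obtain h where h: "h absolutely_integrable_on {0..L}"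
    "\<And>x. x \<in> {0..L} \<Longrightarrow> d3 L z x = d3 L z 0 + integral {0..x} h"
    "negligible {x\<in>{0..L}. d4 L z x \<noteq> h x}"
    using W41_fourth_derivative[OF \<open>L > 0\<close> z(1)] by blast
  define B' where "B' = B \<union> {x\<in>{0..L}. d4 L y x \<noteq> g x} \<union> {x\<in>{0..L}. d4 L z x \<noteq> h x}"
  have B': "negligible B'" using B g h by (simp add: B'_def)
  have I: "integral {0..L} (\<lambda>x. z x - y x) = integral {0..L} z - integral {0..L} y"
    using W41_continuous(1)[OF y(1)] W41_continuous(1)[OF z(1)]
    by (intro Henstock_Kurzweil_Integration.integral_diff integrable_continuous_interval)
  have d3: "d3 L z t - d3 L y t = (d3 L z 0 - d3 L y 0) + integral {0..t} (\<lambda>x. h x - g x)"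
    if t: "t \<in> {0..L}" for t
  proof -
    have "h integrable_on {0..t}" "g integrable_on {0..t}"
      using g(1) h(1) t integrable_on_subinterval[of h "{0..L}" 0 t] integrable_on_subinterval[of g "{0..L}" 0 t]
      by (auto simp: absolutely_integrable_on_def)
    then have "integral {0..t} (\<lambda>x. h x - g x) = integral {0..t} h - integral {0..t} g"
      by (rule Henstock_Kurzweil_Integration.integral_diff)
    then show ?thesis using g(2)[OF t] h(2)[OF t] by linarith
  qed
  have pos: "0 \<le> (h t - g t) - M * (d2 L z t - d2 L y t) + N * integral {0..L} (\<lambda>x. z x - y x)"
    if t: "t \<in> {0..L} - B'" for t
  proof -
    have "d4 L y t = g t" "d4 L z t = h t"
      using t by (auto simp: B'_def)
    moreover have "t \<in> {0..L} - B" using t by (auto simp: B'_def)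
    note bspec[OF B(2) this]
    ultimately have "g t - M * d2 L y t + N * integral {0..L} y \<le> h t - M * d2 L z t + N * integral {0..L} z"
      by simp
    then show ?thesis unfolding I by (simp add: algebra_simps)
  qed
  have hg: "(\<lambda>x. h x - g x) absolutely_integrable_on {0..L}"
    using g(1) h(1) by (intro set_integral_diff)
  note D = DERIV_diff[OF W41_derivatives(1)[OF z(1)] W41_derivatives(1)[OF y(1)]]
    DERIV_diff[OF W41_derivatives(2)[OF z(1)] W41_derivatives(2)[OF y(1)]]
    DERIV_diff[OF W41_derivatives(3)[OF z(1)] W41_derivatives(3)[OF y(1)]]
  have bcs: "z 0 - y 0 = 0" "z L - y L = 0" "d2 L z 0 - d2 L y 0 = 0" "d2 L z L - d2 L y L = 0"
    using y(2) z(2) by (auto simp: bc_def)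
  have "d2 L z x - d2 L y x \<le> 0" "0 \<le> z x - y x" if x: "x \<in> {0..L}" for x
    by (rule nonlocal_beam_maximum_principle[OF assms(1-4) D(1) D(2) D(3) hg d3 bcs B' pos x]; assumption)+
  then show ?thesis
    by (force simp: bend_le_def)
qed

section \<open>The Dirichlet problem \<open>w'' = f\<close>: uniqueness and dependence on
  \<open>f\<close>\<close>

text \<open>The solution of \<open>w'' = f\<close>, \<open>w 0 = w L = 0\<close>.\<close>

definition dirichlet_primitive :: "real \<Rightarrow> (real \<Rightarrow> real) \<Rightarrow> real \<Rightarrow> real" where
  "dirichlet_primitive L f x =
     integral {0..x} (\<lambda>s. integral {0..s} f) - x / L * integral {0..L} (\<lambda>s. integral {0..s} f)"

text \<open>Integrating twice gives \<open>k * x\<close> plus the iterated integral of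
  \<open>f\<close>, and \<open>w L = 0\<close> fixes \<open>k\<close>. Taking \<open>w1\<close> as
  an indefinite integral of \<open>f\<close> admits data as rough as \<open>p\<close>.\<close>

lemma dirichlet_primitive_unique:
  assumes "L > 0" and f: "f integrable_on {0..L}"
    and w: "\<And>x. x \<in> {0..L} \<Longrightarrow> (w has_real_derivative w1 x) (at x within {0..L})"
    and w1: "\<And>x. x \<in> {0..L} \<Longrightarrow> w1 x = k + integral {0..x} f"
    and "w 0 = 0" "w L = 0" and x: "x \<in> {0..L}"
  shows "w x = dirichlet_primitive L f x"
proof -
  define F where "F s = integral {0..s} f" for s
  have cF: "continuous_on {0..L} F"
    unfolding F_def using indefinite_integral_continuous_1[OF f] by simp
  have *: "w y = k * y + integral {0..y} F" if y: "y \<in> {0..L}" for y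
  proof -
    have 1: "(w1 has_integral (w y - w 0)) {0..y}"
    proof (rule fundamental_theorem_of_calculus)
      fix t assume "t \<in> {0..y}"
      then show "(w has_vector_derivative w1 t) (at t within {0..y})"
        using DERIV_subset[OF w, of t "{0..y}"] y
        by (auto simp: has_real_derivative_iff_has_vector_derivative)
    qed (use y in auto)
    have "((\<lambda>t. k + F t) has_integral (k * y + integral {0..y} F)) {0..y}"
    proof (rule has_integral_add)
      show "((\<lambda>t. k) has_integral k * y) {0..y}"
        using has_integral_const_real[of k 0 y] y by (simp add: mult.commute)
      show "(F has_integral integral {0..y} F) {0..y}"
        by (intro integrable_integral integrable_continuous_interval continuous_on_subset[OF cF])
          (use y in auto)
    qed
    then have 2: "(w1 has_integral (k * y + integral {0..y} F)) {0..y}"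
      by (rule has_integral_eq[rotated]) (use w1 y in \<open>auto simp: F_def\<close>)
    show ?thesis using has_integral_unique[OF 1 2] \<open>w 0 = 0\<close> by simp
  qed
  have "k = - integral {0..L} F / L" using *[of L] \<open>L > 0\<close> \<open>w L = 0\<close> by (simp add: field_simps)
  then show ?thesis using *[OF x] by (simp add: dirichlet_primitive_def flip: F_def)
qed

lemma dirichlet_primitive_ends:
  "L > 0 \<Longrightarrow> dirichlet_primitive L f 0 = 0" "L > 0 \<Longrightarrow> dirichlet_primitive L f L = 0"
  by (simp_all add: dirichlet_primitive_def)

lemma dirichlet_primitive_derivative:
  assumes "L > 0" and f: "f integrable_on {0..L}" and x: "x \<in> {0..L}"
  shows "(dirichlet_primitive L f has_real_derivative
      (integral {0..x} f - integral {0..L} (\<lambda>s. integral {0..s} f) / L)) (at x within {0..L})"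
proof -
  have "((\<lambda>x. integral {0..x} (\<lambda>s. integral {0..s} f)) has_real_derivative integral {0..x} f) (at x within {0..L})"
    by (rule integral_has_real_derivative[OF indefinite_integral_continuous_1[OF f] x])
  then show ?thesis
    unfolding dirichlet_primitive_def[abs_def] using \<open>L > 0\<close>
    by (auto intro!: derivative_eq_intros)
qed

text \<open>Dominated convergence acts twice: on the inner integrals \<open>F n\<close>, which are
  bounded by the integral of \<open>h\<close>, and on the L1-distance \<open>e n\<close> from
  \<open>F n\<close> to its limit. The primitives differ by at most \<open>2 * e n\<close> at every
  point: one \<open>e n\<close> for the iterated integral, one for the linear correction.\<close>

lemma dirichlet_primitive_uniform_limit:
  fixes f :: "nat \<Rightarrow> real \<Rightarrow> real"
  assumes "L > 0" and f: "\<And>n. f n integrable_on {0..L}" and h: "h integrable_on {0..L}"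
    and le: "\<And>n x. x \<in> {0..L} \<Longrightarrow> \<bar>f n x\<bar> \<le> h x"
    and lim: "\<And>x. x \<in> {0..L} \<Longrightarrow> (\<lambda>n. f n x) \<longlonglongrightarrow> f' x"
  shows "f' integrable_on {0..L}"
    and "uniform_limit {0..L} (\<lambda>n. dirichlet_primitive L (f n)) (dirichlet_primitive L f') sequentially"
proof -
  show f': "f' integrable_on {0..L}"
    using dominated_convergence(1)[of f "{0..L}" h f'] f h le lim by simp
  define F where "F n s = integral {0..s} (f n)" for n s
  define G where "G s = integral {0..s} f'" for s
  have sub: "k integrable_on {0..s}" if "k integrable_on {0..L}" "s \<in> {0..L}" for k :: "real \<Rightarrow> real" and s
    using integrable_on_subinterval[OF that(1), of 0 s] that(2) by auto
  have cF: "continuous_on {0..L} (F n)" for n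
    unfolding F_def using indefinite_integral_continuous_1[OF f] by simp
  have cG: "continuous_on {0..L} G"
    unfolding G_def using indefinite_integral_continuous_1[OF f'] by simp
  have FG: "(\<lambda>n. F n s) \<longlonglongrightarrow> G s" if s: "s \<in> {0..L}" for s
    unfolding F_def G_def
    by (rule dominated_convergence(2)[where h=h]) (use s f h le lim sub in auto)
  have Fb: "\<bar>F n s\<bar> \<le> integral {0..L} h" if s: "s \<in> {0..L}" for n s
  proof -
    have h0: "0 \<le> h x" if "x \<in> {0..L}" for x using le[OF that, of 0] by linarith
    have "norm (F n s) \<le> integral {0..s} h"
      unfolding F_def by (rule integral_norm_bound_integral) (use s f h le sub in auto)
    also have "\<dots> \<le> integral {0..L} h"
      by (rule integral_subset_le) (use s h h0 sub in auto)
    finally show ?thesis by simp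
  qed
  have Gb: "\<bar>G s\<bar> \<le> integral {0..L} h" if s: "s \<in> {0..L}" for s
    using LIMSEQ_le_const2[OF tendsto_rabs[OF FG[OF s]], of "integral {0..L} h"] Fb[OF s] by blast
  define e where "e n = integral {0..L} (\<lambda>s. \<bar>F n s - G s\<bar>)" for n
  have "e \<longlonglongrightarrow> integral {0..L} (\<lambda>s. 0)"
    unfolding e_def
  proof (rule dominated_convergence(2)[where h="\<lambda>s. 2 * integral {0..L} h"])
    show "(\<lambda>s. \<bar>F n s - G s\<bar>) integrable_on {0..L}" for n
      by (intro integrable_continuous_interval continuous_intros cF cG)
    show "(\<lambda>n. \<bar>F n s - G s\<bar>) \<longlonglongrightarrow> 0" if "s \<in> {0..L}" for s
      using tendsto_rabs[OF tendsto_diff[OF FG[OF that] tendsto_const[of "G s"]]] by simp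
    show "norm \<bar>F n s - G s\<bar> \<le> 2 * integral {0..L} h" if "s \<in> {0..L}" for n s
      using Fb[OF that, of n] Gb[OF that] by simp
  qed auto
  then have e: "e \<longlonglongrightarrow> 0" by simp
  have bound: "\<bar>dirichlet_primitive L (f n) x - dirichlet_primitive L f' x\<bar> \<le> 2 * e n" if x: "x \<in> {0..L}" for n x
  proof -
    have cd: "continuous_on {0..L} (\<lambda>s. F n s - G s)" by (intro continuous_intros cF cG)
    have i: "(\<lambda>s. F n s - G s) integrable_on {0..y}" "(\<lambda>s. \<bar>F n s - G s\<bar>) integrable_on {0..y}"
        "F n integrable_on {0..y}" "G integrable_on {0..y}" if "y \<in> {0..L}" for y
      using that by (auto intro!: integrable_continuous_interval continuous_intros
          intro: continuous_on_subset[OF cF] continuous_on_subset[OF cG])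
    have est: "\<bar>integral {0..y} (F n) - integral {0..y} G\<bar> \<le> e n" if y: "y \<in> {0..L}" for y
    proof -
      have "\<bar>integral {0..y} (F n) - integral {0..y} G\<bar> = norm (integral {0..y} (\<lambda>s. F n s - G s))"
        using i[OF y] by (simp add: Henstock_Kurzweil_Integration.integral_diff)
      also have "\<dots> \<le> integral {0..y} (\<lambda>s. \<bar>F n s - G s\<bar>)"
        by (rule integral_norm_bound_integral) (use i[OF y] in auto)
      also have "\<dots> \<le> e n"
        unfolding e_def by (rule integral_subset_le) (use y i[OF y] i[of L] in auto)
      finally show ?thesis .
    qed
    have "dirichlet_primitive L (f n) x - dirichlet_primitive L f' x
        = (integral {0..x} (F n) - integral {0..x} G) - x / L * (integral {0..L} (F n) - integral {0..L} G)"
      by (simp add: dirichlet_primitive_def F_def[abs_def] G_def[abs_def] algebra_simps)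
    also have "\<bar>\<dots>\<bar> \<le> \<bar>integral {0..x} (F n) - integral {0..x} G\<bar>
        + \<bar>x / L * (integral {0..L} (F n) - integral {0..L} G)\<bar>"
      by (rule abs_triangle_ineq4)
    also have "\<dots> \<le> e n + 1 * e n"
      unfolding abs_mult using x est[of x] est[of L] \<open>L > 0\<close>
      by (intro add_mono mult_mono) auto
    finally show ?thesis by simp
  qed
  show "uniform_limit {0..L} (\<lambda>n. dirichlet_primitive L (f n)) (dirichlet_primitive L f') sequentially"
  proof (rule uniform_limitI)
    fix r :: real assume "r > 0"
    have "(\<lambda>n. 2 * e n) \<longlonglongrightarrow> 0" using tendsto_mult_right_zero[OF e] by simp
    then have "\<forall>\<^sub>F n in sequentially. 2 * e n < r" using \<open>r > 0\<close> by (rule order_tendstoD(2))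
    then show "\<forall>\<^sub>F n in sequentially. \<forall>x\<in>{0..L}.
        dist (dirichlet_primitive L (f n) x) (dirichlet_primitive L f' x) < r"
      by eventually_elim (use bound in \<open>fastforce simp: dist_real_def intro: le_less_trans\<close>)
  qed
qed

section \<open>Limits of the iteration\<close>

lemma W41_eq_dirichlet_primitive:
  assumes "L > 0" "W41 L w" "bc L w" "x \<in> {0..L}"
  shows "w x = dirichlet_primitive L (d2 L w) x"
proof (rule dirichlet_primitive_unique[OF \<open>L > 0\<close> _ W41_derivatives(1)[OF assms(2)] _ _ _ assms(4)])
  show "d2 L w integrable_on {0..L}"
    using W41_continuous(3)[OF assms(2)] by (rule integrable_continuous_interval)
  show "d1 L w y = d1 L w 0 + integral {0..y} (d2 L w)" if y: "y \<in> {0..L}" for y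
  proof -
    have "(d2 L w has_integral (d1 L w y - d1 L w 0)) {0..y}"
    proof (rule fundamental_theorem_of_calculus)
      fix t assume "t \<in> {0..y}"
      then show "(d1 L w has_vector_derivative d2 L w t) (at t within {0..y})"
        using DERIV_subset[OF W41_derivatives(2)[OF assms(2)], of t "{0..y}"] y
        by (auto simp: has_real_derivative_iff_has_vector_derivative)
    qed (use y in auto)
    then show ?thesis by (simp add: integral_unique)
  qed
qed (use assms in \<open>auto simp: bc_def\<close>)

text \<open>\<open>q\<close> and the density of \<open>d3 L w\<close> agree off a negligible set and
  so have the same indefinite integral; uniqueness then applies to \<open>d2 L w\<close>.\<close>

lemma W41_d2_eq_dirichlet_primitive:
  assumes "L > 0" "W41 L w" "bc L w" "x \<in> {0..L}"
    and q: "q integrable_on {0..L}" and AE: "AE x in lborel. x \<in> {0<..<L} \<longrightarrow> d4 L w x = q x"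
  shows "d2 L w x = dirichlet_primitive L q x"
proof (rule dirichlet_primitive_unique[OF \<open>L > 0\<close> q W41_derivatives(3)[OF assms(2)] _ _ _ assms(4)])
  obtain g where g: "g absolutely_integrable_on {0..L}"
    "\<And>x. x \<in> {0..L} \<Longrightarrow> d3 L w x = d3 L w 0 + integral {0..x} g"
    "negligible {x\<in>{0..L}. d4 L w x \<noteq> g x}"
    using W41_fourth_derivative[OF assms(1,2)] by blast
  obtain B where B: "negligible B" "\<forall>x\<in>{0..L} - B. d4 L w x = q x"
    using AE unfolding AE_lborel_interval_iff_negligible by blast
  show "d3 L w y = d3 L w 0 + integral {0..y} q" if y: "y \<in> {0..L}" for y
  proof -
    have "integral {0..y} q = integral {0..y} g"
    proof (rule integral_spike)
      show "negligible (B \<union> {x\<in>{0..L}. d4 L w x \<noteq> g x})" using B g by simp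
      fix t assume t: "t \<in> {0..y} - (B \<union> {x\<in>{0..L}. d4 L w x \<noteq> g x})"
      then have "d4 L w t = q t" using y B(2) by auto
      moreover have "d4 L w t = g t" using t y by auto
      ultimately show "g t = q t" by simp
    qed
    then show ?thesis using g(2)[OF y] by linarith
  qed
qed (use assms in \<open>auto simp: bc_def\<close>)

text \<open>Converse of the two preceding lemmas: a function in \<open>W41\<close> is built from its
  fourth derivative by solving \<open>w'' = f\<close> twice.\<close>

lemma dirichlet_primitive_twice_W41:
  assumes "L > 0" and q: "q absolutely_integrable_on {0..L}"
    and v: "\<And>x. x \<in> {0..L} \<Longrightarrow> v x = dirichlet_primitive L q x"
  defines "Y \<equiv> dirichlet_primitive L v"
  shows "W41 L Y" "bc L Y" "\<And>x. x \<in> {0..L} \<Longrightarrow> d2 L Y x = v x"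
    "AE x in lborel. x \<in> {0<..<L} \<longrightarrow> d4 L Y x = q x"
proof -
  have qi: "q integrable_on {0..L}" using q by (auto simp: absolutely_integrable_on_def)
  define k1 k3 where "k1 = integral {0..L} (\<lambda>s. integral {0..s} v) / L"
    and "k3 = integral {0..L} (\<lambda>s. integral {0..s} q) / L"
  have Dv: "(v has_real_derivative (integral {0..x} q - k3)) (at x within {0..L})" if x: "x \<in> {0..L}" for x
    using has_real_derivative_cong_on[OF dirichlet_primitive_derivative[OF \<open>L > 0\<close> qi x] x] v
    by (simp add: k3_def)
  have cv: "continuous_on {0..L} v"
    using DERIV_continuous[OF Dv] by (auto simp: continuous_on_eq_continuous_within)
  have DY: "(Y has_real_derivative (integral {0..x} v - k1)) (at x within {0..L})" if x: "x \<in> {0..L}" for x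
    unfolding Y_def k1_def
    by (rule dirichlet_primitive_derivative[OF \<open>L > 0\<close> integrable_continuous_interval[OF cv] x])
  have d1: "d1 L Y x = integral {0..x} v - k1" if "x \<in> {0..L}" for x
    using d1_eqI[OF \<open>L > 0\<close> that DY[OF that]] .
  have Dd1: "(d1 L Y has_real_derivative v x) (at x within {0..L})" if x: "x \<in> {0..L}" for x
  proof (rule has_real_derivative_cong_on[OF _ x])
    show "((\<lambda>x. integral {0..x} v - k1) has_real_derivative v x) (at x within {0..L})"
      using integral_has_real_derivative[OF cv x] by (auto intro!: derivative_eq_intros)
  qed (simp add: d1)
  show d2: "d2 L Y x = v x" if "x \<in> {0..L}" for x
    unfolding d2_def using d1_eqI[OF \<open>L > 0\<close> that Dd1[OF that]] .
  have Dd2: "(d2 L Y has_real_derivative (integral {0..x} q - k3)) (at x within {0..L})" if x: "x \<in> {0..L}" for x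
    by (rule has_real_derivative_cong_on[OF Dv[OF x] x]) (simp add: d2)
  have d3: "d3 L Y x = - k3 + integral {0..x} q" if "x \<in> {0..L}" for x
    unfolding d3_def using d1_eqI[OF \<open>L > 0\<close> that Dd2[OF that]] by simp
  have diff: "f differentiable (at x within {0..L})" if "(f has_real_derivative y) (at x within {0..L})"
    for f x and y :: real
    using that by (auto simp: differentiable_def has_field_derivative_def)
  show "W41 L Y"
    unfolding W41_def
  proof (intro conjI ballI exI[of _ q])
    show "d3 L Y x = d3 L Y 0 + integral {0..x} q" if "x \<in> {0..L}" for x
      using d3[OF that] d3[of 0] \<open>L > 0\<close> by simp
  qed (use diff[OF DY] diff[OF Dd1] diff[OF Dd2] q in auto)
  show "bc L Y"
    using \<open>L > 0\<close> dirichlet_primitive_ends[OF \<open>L > 0\<close>] v[of 0] v[of L] d2[of 0] d2[of L]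
    by (simp add: bc_def Y_def)
  show "AE x in lborel. x \<in> {0<..<L} \<longrightarrow> d4 L Y x = q x"
    unfolding AE_lborel_interval_iff_negligible
    using d4_eq_negligible[OF \<open>L > 0\<close> q d3] by (intro exI[of _ "{x\<in>{0..L}. d4 L Y x \<noteq> q x}"]) auto
qed

text \<open>With \<open>Y\<close> the primitive of the pointwise limit of the second derivatives,
  bounded convergence already gives the uniform limit. The equation follows by writing each
  \<open>d2 L (ys (Suc n))\<close> as the primitive of \<open>q n\<close> and letting
  \<open>n\<close> tend to infinity.\<close>

lemma iteration_limit_is_solution:
  fixes ys :: "nat \<Rightarrow> real \<Rightarrow> real"
  assumes "L > 0" and p: "p absolutely_integrable_on {0..L}"
    and y0: "W41 L (ys 0)" "bc L (ys 0)"
    and step: "\<And>n. iter_step L a b c p M N (ys n) (ys (Suc n))"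
    and bound: "\<And>n x. x \<in> {0..L} \<Longrightarrow> \<bar>d2 L (ys n) x\<bar> \<le> B"
    and conv: "\<And>x. x \<in> {0..L} \<Longrightarrow> convergent (\<lambda>n. d2 L (ys n) x)"
  obtains Y where "is_solution L a b c p Y" "uniform_limit {0..L} ys Y sequentially"
    "\<And>x. x \<in> {0..L} \<Longrightarrow> (\<lambda>n. d2 L (ys n) x) \<longlonglongrightarrow> d2 L Y x"
proof -
  define v where "v x = lim (\<lambda>n. d2 L (ys n) x)" for x
  have v: "(\<lambda>n. d2 L (ys n) x) \<longlonglongrightarrow> v x" if "x \<in> {0..L}" for x
    using conv[OF that] by (simp add: v_def convergent_LIMSEQ_iff)
  have W: "W41 L (ys n)" "bc L (ys n)" for n
    using y0 step by (cases n; auto simp: iter_step_def)+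
  have d2int: "d2 L (ys n) integrable_on {0..L}" for n
    using W41_continuous(3)[OF W(1)] by (rule integrable_continuous_interval)
  define Y where "Y = dirichlet_primitive L v"
  have "uniform_limit {0..L} (\<lambda>n. dirichlet_primitive L (d2 L (ys n))) Y sequentially"
    unfolding Y_def
    by (rule dirichlet_primitive_uniform_limit(2)[OF \<open>L > 0\<close> d2int, of "\<lambda>_. B"]) (use bound v in auto)
  then have unif: "uniform_limit {0..L} ys Y sequentially"
    by (rule uniform_limit_cong'[THEN iffD1, rotated -1])
      (use W41_eq_dirichlet_primitive[OF \<open>L > 0\<close> W] in auto)
  define I where "I n = integral {0..L} (ys n)" for n
  define I' where "I' = integral {0..L} Y"
  have I: "I \<longlonglongrightarrow> I'"
  proof -
    obtain I1 J1 where IJ: "\<And>n. (ys n has_integral I1 n) {0..L}" "(Y has_integral J1) {0..L}" "I1 \<longlonglongrightarrow> J1"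
      by (rule uniform_limit_integral[OF unif W41_continuous(1)[OF W(1)]]) auto
    have "I = I1" "I' = J1" using IJ by (auto simp: I_def I'_def integral_unique)
    then show ?thesis using IJ by simp
  qed
  then obtain D where D: "D > 0" "\<And>n. \<bar>I n\<bar> \<le> D"
    using convergentI Bseq_def convergent_imp_Bseq by (metis real_norm_def)
  \<comment> \<open>The iteration equation solved for the fourth derivative of
    \<open>ys (Suc n)\<close>; hence the terms with \<open>Suc n\<close>.\<close>
  define q where "q n x = p x + ((a + b * I n) * d2 L (ys n) x - c * I n - M * d2 L (ys n) x + N * I n
      + M * d2 L (ys (Suc n)) x - N * I (Suc n))" for n x
  \<comment> \<open>Left uncancelled so that it is the termwise limit of \<open>q n\<close>. The
    \<open>M\<close> and \<open>N\<close> terms cancel in it, which turns the linear step into the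
    original equation.\<close>
  define q' where "q' x = p x + ((a + b * I') * v x - c * I' - M * v x + N * I' + M * v x - N * I')" for x
  have pint: "p integrable_on {0..L}" "(\<lambda>x. \<bar>p x\<bar>) integrable_on {0..L}"
    using p by (auto simp: absolutely_integrable_on_def)
  have qint: "q n integrable_on {0..L}" for n
    unfolding q_def
    by (intro integrable_add pint integrable_continuous_interval continuous_intros W41_continuous(3) W)
  define K where "K = (\<bar>a\<bar> + \<bar>b\<bar> * D) * B + \<bar>c\<bar> * D + \<bar>M\<bar> * B + \<bar>N\<bar> * D + \<bar>M\<bar> * B + \<bar>N\<bar> * D"
  have qle: "\<bar>q n x\<bar> \<le> \<bar>p x\<bar> + K" if x: "x \<in> {0..L}" for n x
  proof -
    have "\<bar>b * I n\<bar> \<le> \<bar>b\<bar> * D" using D by (simp add: abs_mult mult_left_mono)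
    then have "\<bar>a + b * I n\<bar> \<le> \<bar>a\<bar> + \<bar>b\<bar> * D" by linarith
    then have "\<bar>(a + b * I n) * d2 L (ys n) x\<bar> \<le> (\<bar>a\<bar> + \<bar>b\<bar> * D) * B"
      unfolding abs_mult using bound[OF x] D(1) by (intro mult_mono) auto
    moreover have "\<bar>c * I n\<bar> \<le> \<bar>c\<bar> * D" "\<bar>N * I n\<bar> \<le> \<bar>N\<bar> * D" "\<bar>N * I (Suc n)\<bar> \<le> \<bar>N\<bar> * D"
      "\<bar>M * d2 L (ys n) x\<bar> \<le> \<bar>M\<bar> * B" "\<bar>M * d2 L (ys (Suc n)) x\<bar> \<le> \<bar>M\<bar> * B"
      unfolding abs_mult using D(2) bound[OF x] by (intro mult_left_mono abs_ge_zero; blast)+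
    moreover have "\<bar>w + (x1 - x2 - x3 + x4 + x5 - x6)\<bar> \<le> \<bar>w\<bar> + (k1 + k2 + k3 + k4 + k3 + k4)"
      if "\<bar>x1\<bar> \<le> k1" "\<bar>x2\<bar> \<le> k2" "\<bar>x4\<bar> \<le> k4" "\<bar>x6\<bar> \<le> k4" "\<bar>x3\<bar> \<le> k3" "\<bar>x5\<bar> \<le> k3"
      for w x1 x2 x3 x4 x5 x6 k1 k2 k3 k4 :: real
      using that[THEN abs_le_D1] that[THEN abs_le_D2] abs_ge_self[of w] abs_ge_minus_self[of w]
      by (intro abs_leI) linarith+
    ultimately show ?thesis unfolding q_def K_def by blast
  qed
  have qlim: "(\<lambda>n. q n x) \<longlonglongrightarrow> q' x" if x: "x \<in> {0..L}" for x
    unfolding q_def q'_def by (intro tendsto_intros I v[OF x] LIMSEQ_Suc[OF I] LIMSEQ_Suc[OF v[OF x]])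
  have "uniform_limit {0..L} (\<lambda>n. dirichlet_primitive L (q n)) (dirichlet_primitive L q') sequentially"
    by (rule dirichlet_primitive_uniform_limit(2)[OF \<open>L > 0\<close> qint _ qle qlim]) (auto intro: integrable_add pint)
  then have lim2: "(\<lambda>n. dirichlet_primitive L (q n) x) \<longlonglongrightarrow> dirichlet_primitive L q' x" if "x \<in> {0..L}" for x
    using that by (rule tendsto_uniform_limitI)
  have d2q: "d2 L (ys (Suc n)) x = dirichlet_primitive L (q n) x" if x: "x \<in> {0..L}" for n x
  proof (rule W41_d2_eq_dirichlet_primitive[OF \<open>L > 0\<close> W x qint])
    have "AE x in lborel. x \<in> {0<..<L} \<longrightarrow>
        d4 L (ys (Suc n)) x - M * d2 L (ys (Suc n)) x + N * I (Suc n) =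
        p x + (a + b * I n) * d2 L (ys n) x - c * I n - M * d2 L (ys n) x + N * I n"
      using step[of n] by (simp add: iter_step_def I_def)
    then show "AE x in lborel. x \<in> {0<..<L} \<longrightarrow> d4 L (ys (Suc n)) x = q n x"
      by eventually_elim (auto simp: q_def)
  qed
  have vq: "v x = dirichlet_primitive L q' x" if x: "x \<in> {0..L}" for x
  proof (rule LIMSEQ_unique[OF LIMSEQ_Suc[OF v[OF x]]])
    show "(\<lambda>n. d2 L (ys (Suc n)) x) \<longlonglongrightarrow> dirichlet_primitive L q' x"
      unfolding d2q[OF x] by (rule lim2[OF x])
  qed
  \<comment> \<open>As a pointwise limit, \<open>v\<close> gains continuity only from being a
    primitive of \<open>q'\<close>; this in turn makes \<open>q'\<close> absolutely integrable, as
    \<open>W41\<close> demands.\<close>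
  have "continuous_on {0..L} v"
  proof -
    have "q' integrable_on {0..L}"
      by (rule dirichlet_primitive_uniform_limit(1)[OF \<open>L > 0\<close> qint _ qle qlim]) (auto intro: integrable_add pint)
    then have "continuous_on {0..L} (dirichlet_primitive L q')"
      unfolding continuous_on_eq_continuous_within
      using DERIV_continuous[OF dirichlet_primitive_derivative[OF \<open>L > 0\<close>]] by blast
    then show ?thesis by (subst continuous_on_cong[OF refl vq])
  qed
  then have q'abs: "q' absolutely_integrable_on {0..L}"
    unfolding q'_def
    by (intro set_integral_add p absolutely_integrable_continuous_real continuous_intros)
  have Y: "W41 L Y" "bc L Y" "\<And>x. x \<in> {0..L} \<Longrightarrow> d2 L Y x = v x"
    "AE x in lborel. x \<in> {0<..<L} \<longrightarrow> d4 L Y x = q' x"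
    unfolding Y_def by (rule dirichlet_primitive_twice_W41[OF \<open>L > 0\<close> q'abs vq]; assumption)+
  have "AE x in lborel. x \<in> {0<..<L} \<longrightarrow>
        d4 L Y x - (a + b * integral {0..L} Y) * d2 L Y x + c * integral {0..L} Y = p x"
    using Y(4) by eventually_elim (auto simp: q'_def I'_def Y(3))
  then have "is_solution L a b c p Y"
    using Y(1,2) by (simp add: is_solution_def)
  with unif show thesis using v Y(3) by (intro that[of Y]) auto
qed

section \<open>Extremal solutions\<close>

lemma bend_le_limit:
  fixes ys :: "nat \<Rightarrow> real \<Rightarrow> real"
  assumes "uniform_limit {0..L} ys Y sequentially"
    and d2: "\<And>x. x \<in> {0..L} \<Longrightarrow> (\<lambda>n. d2 L (ys n) x) \<longlonglongrightarrow> d2 L Y x"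
  shows "(\<And>n. bend_le L u (ys n)) \<Longrightarrow> bend_le L u Y"
    and "(\<And>n. bend_le L (ys n) u) \<Longrightarrow> bend_le L Y u"
proof -
  have y: "(\<lambda>n. ys n x) \<longlonglongrightarrow> Y x" if "x \<in> {0..L}" for x
    using assms(1) that by (rule tendsto_uniform_limitI)
  show "bend_le L u Y" if "\<And>n. bend_le L u (ys n)"
    using that LIMSEQ_le_const[OF y] LIMSEQ_le_const2[OF d2] unfolding bend_le_def by blast
  show "bend_le L Y u" if "\<And>n. bend_le L (ys n) u"
    using that LIMSEQ_le_const2[OF y] LIMSEQ_le_const[OF d2] unfolding bend_le_def by blast
qed

text \<open>The second derivatives are monotone and trapped between those of \<open>\<beta>\<close>
  and \<open>\<alpha>\<close>, so they converge at every point. The disjunction in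
  \<open>mono\<close> lets increasing and decreasing sequences share one argument.\<close>

lemma monotone_iteration_converges:
  fixes ys :: "nat \<Rightarrow> real \<Rightarrow> real"
  assumes "L > 0" and p: "p absolutely_integrable_on {0..L}"
    and y0: "W41 L (ys 0)" "bc L (ys 0)"
    and step: "\<And>n. iter_step L a b c p M N (ys n) (ys (Suc n))"
    and \<alpha>: "W41 L \<alpha>" and \<beta>: "W41 L \<beta>"
    and between: "\<And>n. bend_le L \<alpha> (ys n)" "\<And>n. bend_le L (ys n) \<beta>"
    and mono: "(\<forall>n. bend_le L (ys n) (ys (Suc n))) \<or> (\<forall>n. bend_le L (ys (Suc n)) (ys n))"
  obtains Y where "is_solution L a b c p Y" "in_order_interval L \<alpha> \<beta> Y"
    "uniform_limit {0..L} ys Y sequentially"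
    "\<And>x. x \<in> {0..L} \<Longrightarrow> (\<lambda>n. d2 L (ys n) x) \<longlonglongrightarrow> d2 L Y x"
proof -
  have "\<exists>C>0. \<forall>x\<in>{0..L}. \<bar>d2 L w x\<bar> \<le> C" if "W41 L w" for w
    using compact_imp_bounded[OF compact_continuous_image[OF W41_continuous(3)[OF that] compact_Icc]]
    unfolding bounded_pos by auto
  then obtain A B where A: "\<forall>x\<in>{0..L}. \<bar>d2 L \<alpha> x\<bar> \<le> A" and B: "\<forall>x\<in>{0..L}. \<bar>d2 L \<beta> x\<bar> \<le> B"
    using \<alpha> \<beta> by meson
  have bound: "\<bar>d2 L (ys n) x\<bar> \<le> max A B" if x: "x \<in> {0..L}" for n x
  proof -
    have "d2 L \<beta> x \<le> d2 L (ys n) x" "d2 L (ys n) x \<le> d2 L \<alpha> x"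
      using between x by (auto simp: bend_le_def)
    moreover have "\<bar>d2 L \<alpha> x\<bar> \<le> A" "\<bar>d2 L \<beta> x\<bar> \<le> B" using A B x by auto
    ultimately show ?thesis by linarith
  qed
  have conv: "convergent (\<lambda>n. d2 L (ys n) x)" if x: "x \<in> {0..L}" for x
  proof (rule Bseq_monoseq_convergent)
    show "Bseq (\<lambda>n. d2 L (ys n) x)"
      using bound[OF x] by (intro BseqI'[of _ "max A B"]) auto
    show "monoseq (\<lambda>n. d2 L (ys n) x)"
      using mono x unfolding monoseq_Suc bend_le_def by blast
  qed
  obtain Y where Y: "is_solution L a b c p Y" "uniform_limit {0..L} ys Y sequentially"
    "\<And>x. x \<in> {0..L} \<Longrightarrow> (\<lambda>n. d2 L (ys n) x) \<longlonglongrightarrow> d2 L Y x"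
    using iteration_limit_is_solution[OF \<open>L > 0\<close> p y0 step bound conv] by blast
  have "bend_le L \<alpha> Y" "bend_le L Y \<beta>"
    using bend_le_limit[OF Y(2,3)] between by blast+
  then have "in_order_interval L \<alpha> \<beta> Y"
    using W41_imp_C2[of L Y] Y(1) by (simp add: in_order_interval_def is_solution_def bend_le_def)
  with Y show thesis using that by blast
qed

theorem theorem4p1:
  fixes L a b c M N :: real and p \<alpha> \<beta> :: "real \<Rightarrow> real"
    and \<alpha>s \<beta>s :: "nat \<Rightarrow> real \<Rightarrow> real"
  assumes "L > 0" and "a > 0" and "b > 0" and "c > 0"
    and "p absolutely_integrable_on {0..L}"
    and "M > 0" and "N > 0"
    and "N \<le> 4 * M / L^3 * sigma (sqrt M * L)"
    and "is_lower_solution L a b c p \<alpha>" and "is_upper_solution L a b c p \<beta>"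
    and "\<forall>x\<in>{0..L}. 0 \<le> \<alpha> x \<and> \<alpha> x \<le> \<beta> x"
    and "\<forall>x\<in>{0..L}. 0 \<ge> d2 L \<alpha> x \<and> d2 L \<alpha> x \<ge> d2 L \<beta> x"
    and "a + b * integral {0..L} \<beta> \<le> M"
    and "c - b * (INF x\<in>{0..L}. d2 L \<beta> x) \<le> N"
    and "\<alpha>s 0 = \<alpha>" and "\<forall>n. iter_step L a b c p M N (\<alpha>s n) (\<alpha>s (Suc n))"
    and "\<beta>s 0 = \<beta>" and "\<forall>n. iter_step L a b c p M N (\<beta>s n) (\<beta>s (Suc n))"
  shows "(\<exists>w. is_solution L a b c p w \<and> in_order_interval L \<alpha> \<beta> w)
    \<and> (\<forall>n. \<forall>x\<in>{0..L}. \<alpha>s n x \<le> \<alpha>s (Suc n) x \<and> \<alpha>s n x \<le> \<beta>s n x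
                        \<and> \<beta>s (Suc n) x \<le> \<beta>s n x)
    \<and> (\<forall>n. \<forall>x\<in>{0..L}. d2 L (\<alpha>s n) x \<ge> d2 L (\<alpha>s (Suc n)) x
                        \<and> d2 L (\<alpha>s n) x \<ge> d2 L (\<beta>s n) x
                        \<and> d2 L (\<beta>s (Suc n)) x \<ge> d2 L (\<beta>s n) x)
    \<and> (\<exists>ylo yhi.
         is_solution L a b c p ylo \<and> in_order_interval L \<alpha> \<beta> ylo \<and>
         is_solution L a b c p yhi \<and> in_order_interval L \<alpha> \<beta> yhi \<and>
         uniform_limit {0..L} \<alpha>s ylo sequentially \<and>
         uniform_limit {0..L} \<beta>s yhi sequentially \<and>
         (\<forall>y. is_solution L a b c p y \<and> in_order_interval L \<alpha> \<beta> y \<longrightarrow>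
            (\<forall>x\<in>{0..L}. ylo x \<le> y x \<and> y x \<le> yhi x \<and>
                         d2 L ylo x \<ge> d2 L y x \<and> d2 L y x \<ge> d2 L yhi x)))"
proof -
  note pos = \<open>L > 0\<close> \<open>M > 0\<close> \<open>N > 0\<close> \<open>N \<le> 4 * M / L^3 * sigma (sqrt M * L)\<close>

  \<comment> \<open>Monotonicity of the iteration step\<close>
  define lhs where "lhs y x = d4 L y x - M * d2 L y x + N * integral {0..L} y" for y x
  define rhs where "rhs z x = p x + (a + b * integral {0..L} z) * d2 L z x - c * integral {0..L} z
    - M * d2 L z x + N * integral {0..L} z" for z x
  \<comment> \<open>\<open>y\<close> is a lower solution of the linear step with data
    \<open>z\<close>. An iterate is both lower and upper for its predecessor, a solution of the
    problem is so for itself, and \<open>\<alpha>\<close> and \<open>\<beta>\<close> are so on one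
    side each; one comparison then serves all cases.\<close>
  define lower where "lower z y \<longleftrightarrow> W41 L y \<and> bc L y \<and> (AE x in lborel. x \<in> {0<..<L} \<longrightarrow> lhs y x \<le> rhs z x)" for z y
  define upper where "upper z y \<longleftrightarrow> W41 L y \<and> bc L y \<and> (AE x in lborel. x \<in> {0<..<L} \<longrightarrow> rhs z x \<le> lhs y x)" for z y
  have \<alpha>: "W41 L \<alpha>" "bc L \<alpha>" and \<beta>: "W41 L \<beta>" "bc L \<beta>"
    using \<open>is_lower_solution L a b c p \<alpha>\<close> \<open>is_upper_solution L a b c p \<beta>\<close>
    by (auto simp: is_lower_solution_def is_upper_solution_def)
  have lower_\<alpha>: "lower \<alpha> \<alpha>"
  proof -
    have "AE x in lborel. x \<in> {0<..<L} \<longrightarrow>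
        d4 L \<alpha> x - (a + b * integral {0..L} \<alpha>) * d2 L \<alpha> x + c * integral {0..L} \<alpha> \<le> p x"
      using \<open>is_lower_solution L a b c p \<alpha>\<close> by (simp add: is_lower_solution_def)
    then have "AE x in lborel. x \<in> {0<..<L} \<longrightarrow> lhs \<alpha> x \<le> rhs \<alpha> x"
      by eventually_elim (auto simp: lhs_def rhs_def)
    then show ?thesis using \<alpha> by (simp add: lower_def)
  qed
  have upper_\<beta>: "upper \<beta> \<beta>"
  proof -
    have "AE x in lborel. x \<in> {0<..<L} \<longrightarrow>
        d4 L \<beta> x - (a + b * integral {0..L} \<beta>) * d2 L \<beta> x + c * integral {0..L} \<beta> \<ge> p x"
      using \<open>is_upper_solution L a b c p \<beta>\<close> by (simp add: is_upper_solution_def)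
    then have "AE x in lborel. x \<in> {0<..<L} \<longrightarrow> rhs \<beta> x \<le> lhs \<beta> x"
      by eventually_elim (auto simp: lhs_def rhs_def)
    then show ?thesis using \<beta> by (simp add: upper_def)
  qed
  have fixed: "lower y y" "upper y y" if "is_solution L a b c p y" for y
  proof -
    have y: "W41 L y" "bc L y" using that by (auto simp: is_solution_def)
    have "AE x in lborel. x \<in> {0<..<L} \<longrightarrow>
        d4 L y x - (a + b * integral {0..L} y) * d2 L y x + c * integral {0..L} y = p x"
      using that by (simp add: is_solution_def)
    then have "AE x in lborel. x \<in> {0<..<L} \<longrightarrow> lhs y x = rhs y x"
      by eventually_elim (auto simp: lhs_def rhs_def)
    then show "lower y y" "upper y y" using y
      by (auto simp: lower_def upper_def elim: eventually_mono)
  qed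
  have step: "lower z y" "upper z y" if "iter_step L a b c p M N z y" for z y
    using that by (auto simp: iter_step_def lower_def upper_def lhs_def rhs_def elim: eventually_mono)
  have d2\<beta>: "(INF x\<in>{0..L}. d2 L \<beta> x) \<le> d2 L \<beta> x" if "x \<in> {0..L}" for x
    using compact_imp_bounded[OF compact_continuous_image[OF W41_continuous(3)[OF \<beta>(1)] compact_Icc]] that
    by (intro cINF_lower bounded_imp_bdd_below)
  have int_mono: "integral {0..L} u \<le> integral {0..L} v" if "W41 L u" "W41 L v" "bend_le L u v" for u v
    using that by (intro integral_le integrable_continuous_interval W41_continuous(1)) (auto simp: bend_le_def)
  have rhs_mono: "rhs z1 x \<le> rhs z2 x"
    if z: "W41 L z1" "W41 L z2" "bend_le L z1 z2" "bend_le L z2 \<beta>" and x: "x \<in> {0..L}" for z1 z2 x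
  proof -
    define I1 I2 where "I1 = integral {0..L} z1" and "I2 = integral {0..L} z2"
    have I: "I1 \<le> I2" "I2 \<le> integral {0..L} \<beta>"
      using int_mono z \<beta> by (auto simp: I1_def I2_def)
    have d: "d2 L z2 x \<le> d2 L z1 x" "d2 L \<beta> x \<le> d2 L z2 x"
      using z x by (auto simp: bend_le_def)
    have "a + b * I2 \<le> M"
      using mult_left_mono[OF I(2), of b] \<open>b > 0\<close> \<open>a + b * integral {0..L} \<beta> \<le> M\<close> by linarith
    then have 1: "0 \<le> (M - (a + b * I2)) * (d2 L z1 x - d2 L z2 x)"
      using d by (intro mult_nonneg_nonneg) auto
    have "b * (INF x\<in>{0..L}. d2 L \<beta> x) \<le> b * d2 L z1 x"
      using d d2\<beta>[OF x] \<open>b > 0\<close> by (intro mult_left_mono) auto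
    then have "0 \<le> N - c + b * d2 L z1 x"
      using \<open>c - b * (INF x\<in>{0..L}. d2 L \<beta> x) \<le> N\<close> by linarith
    then have 2: "0 \<le> (I2 - I1) * (N - c + b * d2 L z1 x)"
      using I by (intro mult_nonneg_nonneg) auto
    \<comment> \<open>The difference is regrouped around \<open>(a + b * I2) * d2 L z1 x\<close>.
      The first product is nonnegative by the bound on \<open>M\<close>, as \<open>I2\<close> is at
      most the integral of \<open>\<beta>\<close>; the second by the bound on \<open>N\<close>, as
      \<open>d2 L z1 x\<close> is at least the infimum of \<open>d2 L \<beta>\<close>.\<close>
    have "rhs z2 x - rhs z1 x = (M - (a + b * I2)) * (d2 L z1 x - d2 L z2 x) + (I2 - I1) * (N - c + b * d2 L z1 x)"
      unfolding rhs_def I1_def[symmetric] I2_def[symmetric] by (simp add: algebra_simps)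
    with 1 2 show ?thesis by linarith
  qed
  \<comment> \<open>Almost everywhere \<open>lhs y1 \<le> rhs z1 \<le> rhs z2 \<le> lhs y2\<close>,
    and the maximum principle turns this into the order of \<open>y1\<close> and
    \<open>y2\<close>.\<close>
  have compare: "bend_le L y1 y2"
    if y: "lower z1 y1" "upper z2 y2" and z: "W41 L z1" "W41 L z2" "bend_le L z1 z2" "bend_le L z2 \<beta>"
    for y1 y2 z1 z2
  proof (rule beam_comparison[OF pos])
    have "AE x in lborel. x \<in> {0<..<L} \<longrightarrow> lhs y1 x \<le> rhs z1 x"
      "AE x in lborel. x \<in> {0<..<L} \<longrightarrow> rhs z2 x \<le> lhs y2 x"
      using y by (auto simp: lower_def upper_def)
    then have "AE x in lborel. x \<in> {0<..<L} \<longrightarrow> lhs y1 x \<le> lhs y2 x"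
    proof eventually_elim
      case (elim x)
      then show ?case using rhs_mono[OF z, of x] by auto
    qed
    then show "AE x in lborel. x \<in> {0<..<L} \<longrightarrow>
      d4 L y1 x - M * d2 L y1 x + N * integral {0..L} y1 \<le> d4 L y2 x - M * d2 L y2 x + N * integral {0..L} y2"
      by (simp add: lhs_def)
  qed (use y in \<open>auto simp: lower_def upper_def\<close>)

  \<comment> \<open>Ordering and limits of the two sequences\<close>
  have s\<alpha>: "iter_step L a b c p M N (\<alpha>s n) (\<alpha>s (Suc n))" and s\<beta>: "iter_step L a b c p M N (\<beta>s n) (\<beta>s (Suc n))" for n
    using \<open>\<forall>n. iter_step L a b c p M N (\<alpha>s n) (\<alpha>s (Suc n))\<close>
      \<open>\<forall>n. iter_step L a b c p M N (\<beta>s n) (\<beta>s (Suc n))\<close> by auto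
  have W\<alpha>: "W41 L (\<alpha>s n)" for n
    using \<alpha> s\<alpha> \<open>\<alpha>s 0 = \<alpha>\<close> by (cases n) (auto simp: iter_step_def)
  have W\<beta>: "W41 L (\<beta>s n)" for n
    using \<beta> s\<beta> \<open>\<beta>s 0 = \<beta>\<close> by (cases n) (auto simp: iter_step_def)
  have \<alpha>\<beta>: "bend_le L \<alpha> \<beta>"
    using \<open>\<forall>x\<in>{0..L}. 0 \<le> \<alpha> x \<and> \<alpha> x \<le> \<beta> x\<close> \<open>\<forall>x\<in>{0..L}. 0 \<ge> d2 L \<alpha> x \<and> d2 L \<alpha> x \<ge> d2 L \<beta> x\<close>
    by (auto simp: bend_le_def)
  \<comment> \<open>The bound by \<open>\<beta>\<close> is carried along because
    \<open>compare\<close> needs the larger data below \<open>\<beta>\<close>; the bound by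
    \<open>\<alpha>\<close> places the limits in the order interval.\<close>
  have chain: "bend_le L (\<alpha>s n) (\<alpha>s (Suc n)) \<and> bend_le L (\<alpha>s n) (\<beta>s n) \<and> bend_le L (\<beta>s (Suc n)) (\<beta>s n)
      \<and> bend_le L (\<beta>s n) \<beta> \<and> bend_le L \<alpha> (\<alpha>s n)" for n
  proof (induction n)
    case 0
    have "bend_le L \<alpha> (\<alpha>s 1)"
      using compare[OF lower_\<alpha> step(2)[OF s\<alpha>[of 0]]] \<alpha> \<alpha>\<beta> \<open>\<alpha>s 0 = \<alpha>\<close> by (simp add: bend_le_refl)
    moreover have "bend_le L (\<beta>s 1) \<beta>"
      using compare[OF step(1)[OF s\<beta>[of 0]] upper_\<beta>] \<beta> \<open>\<beta>s 0 = \<beta>\<close> by (simp add: bend_le_refl)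
    ultimately show ?case
      using \<alpha>\<beta> \<open>\<alpha>s 0 = \<alpha>\<close> \<open>\<beta>s 0 = \<beta>\<close> by (simp add: bend_le_refl)
  next
    case (Suc n)
    have \<beta>': "bend_le L (\<beta>s (Suc n)) \<beta>" using Suc bend_le_trans by blast
    \<comment> \<open>Proved first: together with \<open>\<beta>'\<close> it puts
      \<open>\<alpha>s (Suc n)\<close> below \<open>\<beta>\<close>, as the next comparison
      requires.\<close>
    have \<alpha>\<beta>': "bend_le L (\<alpha>s (Suc n)) (\<beta>s (Suc n))"
      using compare[OF step(1)[OF s\<alpha>] step(2)[OF s\<beta>] W\<alpha> W\<beta>] Suc by blast
    moreover have "bend_le L (\<alpha>s (Suc n)) (\<alpha>s (Suc (Suc n)))"
      using compare[OF step(1)[OF s\<alpha>] step(2)[OF s\<alpha>] W\<alpha> W\<alpha>] Suc bend_le_trans[OF \<alpha>\<beta>' \<beta>'] by blast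
    moreover have "bend_le L (\<beta>s (Suc (Suc n))) (\<beta>s (Suc n))"
      using compare[OF step(1)[OF s\<beta>] step(2)[OF s\<beta>] W\<beta> W\<beta>] Suc by blast
    moreover have "bend_le L \<alpha> (\<alpha>s (Suc n))" using Suc bend_le_trans by blast
    ultimately show ?case using \<beta>' by blast
  qed
  \<comment> \<open>A solution is a fixed point of the step, so comparing it with the iterates keeps
    it between them at every stage; in the limit this makes \<open>ylo\<close> and
    \<open>yhi\<close> extremal.\<close>
  have sol: "bend_le L (\<alpha>s n) y \<and> bend_le L y (\<beta>s n)"
    if y: "is_solution L a b c p y" "in_order_interval L \<alpha> \<beta> y" for y n
  proof (induction n)
    case 0
    then show ?case
      using y(2) \<open>\<alpha>s 0 = \<alpha>\<close> \<open>\<beta>s 0 = \<beta>\<close> by (auto simp: in_order_interval_def bend_le_def)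
  next
    case (Suc n)
    have Wy: "W41 L y" using y by (simp add: is_solution_def)
    have y\<beta>: "bend_le L y \<beta>" using y(2) by (auto simp: in_order_interval_def bend_le_def)
    show ?case
      using compare[OF step(1)[OF s\<alpha>] fixed(2)[OF y(1)] W\<alpha> Wy] compare[OF fixed(1)[OF y(1)] step(2)[OF s\<beta>] Wy W\<beta>]
        Suc y\<beta> chain by blast
  qed
  have "bend_le L \<alpha> (\<alpha>s n)" "bend_le L (\<alpha>s n) \<beta>" "bend_le L \<alpha> (\<beta>s n)" "bend_le L (\<beta>s n) \<beta>" for n
    using chain[of n] bend_le_trans by blast+
  note between = this
  have \<alpha>0: "W41 L (\<alpha>s 0)" "bc L (\<alpha>s 0)" and \<beta>0: "W41 L (\<beta>s 0)" "bc L (\<beta>s 0)"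
    using \<alpha> \<beta> \<open>\<alpha>s 0 = \<alpha>\<close> \<open>\<beta>s 0 = \<beta>\<close> by auto
  have m\<alpha>: "(\<forall>n. bend_le L (\<alpha>s n) (\<alpha>s (Suc n))) \<or> (\<forall>n. bend_le L (\<alpha>s (Suc n)) (\<alpha>s n))"
    and m\<beta>: "(\<forall>n. bend_le L (\<beta>s n) (\<beta>s (Suc n))) \<or> (\<forall>n. bend_le L (\<beta>s (Suc n)) (\<beta>s n))"
    using chain by blast+
  obtain ylo where lo: "is_solution L a b c p ylo" "in_order_interval L \<alpha> \<beta> ylo"
    "uniform_limit {0..L} \<alpha>s ylo sequentially"
    "\<And>x. x \<in> {0..L} \<Longrightarrow> (\<lambda>n. d2 L (\<alpha>s n) x) \<longlonglongrightarrow> d2 L ylo x"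
    by (rule monotone_iteration_converges[OF \<open>L > 0\<close> \<open>p absolutely_integrable_on {0..L}\<close> \<alpha>0 s\<alpha>
          \<alpha>(1) \<beta>(1) between(1,2) m\<alpha>]) blast
  obtain yhi where hi: "is_solution L a b c p yhi" "in_order_interval L \<alpha> \<beta> yhi"
    "uniform_limit {0..L} \<beta>s yhi sequentially"
    "\<And>x. x \<in> {0..L} \<Longrightarrow> (\<lambda>n. d2 L (\<beta>s n) x) \<longlonglongrightarrow> d2 L yhi x"
    by (rule monotone_iteration_converges[OF \<open>L > 0\<close> \<open>p absolutely_integrable_on {0..L}\<close> \<beta>0 s\<beta>
          \<alpha>(1) \<beta>(1) between(3,4) m\<beta>]) blast
  have ext: "bend_le L ylo y \<and> bend_le L y yhi"
    if "is_solution L a b c p y" "in_order_interval L \<alpha> \<beta> y" for y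
    using bend_le_limit(2)[OF lo(3,4)] bend_le_limit(1)[OF hi(3,4)] sol[OF that]
    by blast
  show ?thesis
  proof (intro conjI)
    show "\<exists>w. is_solution L a b c p w \<and> in_order_interval L \<alpha> \<beta> w" using lo by blast
    show "\<forall>n. \<forall>x\<in>{0..L}. \<alpha>s n x \<le> \<alpha>s (Suc n) x \<and> \<alpha>s n x \<le> \<beta>s n x \<and> \<beta>s (Suc n) x \<le> \<beta>s n x"
      using chain unfolding bend_le_def by blast
    show "\<forall>n. \<forall>x\<in>{0..L}. d2 L (\<alpha>s n) x \<ge> d2 L (\<alpha>s (Suc n)) x
        \<and> d2 L (\<alpha>s n) x \<ge> d2 L (\<beta>s n) x \<and> d2 L (\<beta>s (Suc n)) x \<ge> d2 L (\<beta>s n) x"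
      using chain unfolding bend_le_def by blast
    show "\<exists>ylo yhi.
         is_solution L a b c p ylo \<and> in_order_interval L \<alpha> \<beta> ylo \<and>
         is_solution L a b c p yhi \<and> in_order_interval L \<alpha> \<beta> yhi \<and>
         uniform_limit {0..L} \<alpha>s ylo sequentially \<and>
         uniform_limit {0..L} \<beta>s yhi sequentially \<and>
         (\<forall>y. is_solution L a b c p y \<and> in_order_interval L \<alpha> \<beta> y \<longrightarrow>
            (\<forall>x\<in>{0..L}. ylo x \<le> y x \<and> y x \<le> yhi x \<and>
                         d2 L ylo x \<ge> d2 L y x \<and> d2 L y x \<ge> d2 L yhi x))"
      using lo hi ext unfolding bend_le_def by (intro exI[of _ ylo] exI[of _ yhi]) blast
  qed
qed

end
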